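(* Let $A$ be a worm and $\zeta$ a limit ordinal. Then for all sufficiently large $\theta<\zeta$ (i.e. there is $\xi<\zeta$ such that for all $\theta$ with $\xi\le\theta<\zeta$), $$o_\theta(A)=e^{-\theta+\zeta}\,o_\zeta(A)=e^{\omega^{\ell\zeta}}\,o_\zeta(A)=e_{\ell\zeta}(o_\zeta(A)).$$
   Context: $\mathsf{On}$ is the class of all ordinals. For $\theta\le\zeta$, $-\theta+\zeta$ is the unique ordinal $\eta$ with $\theta+\eta=\zeta$. For $\eta>0$, $\ell\eta$ is the unique $\beta$ such that $\eta=\alpha+\omega^\beta$ for some $\alpha$; $\ell 0=0$. Formulas of the Reflection Calculus $\mathsf{RC}$ are given by $\phi ::= \top \mid \phi\wedge\psi \mid \alpha\phi$ with $\alpha$ any ordinal ($\alpha\phi$ is also written $\langle\alpha\rangle\phi$). We write $\phi\vdash\psi$ if this sequent is derivable from: $\phi\vdash\phi$; $\phi\vdash\top$; $\phi\wedge\psi\vdash\phi$; $\phi\wedge\psi\vdash\psi$; $\alpha\alpha\phi\vdash\alpha\phi$; $\beta\phi\vdash\alpha\phi$ and $\beta\phi\wedge\alpha\psi\vdash\beta(\phi\wedge\alpha\psi)$ for $\alpha<\beta$; with the rules: from $\phi\vdash\psi$ and $\psi\vdash\chi$ infer $\phi\vdash\chi$; from $\phi\vdash\psi$ and $\phi\vdash\chi$ infer $\phi\vdash\psi\wedge\chi$; from $\phi\vdash\psi$ infer $\alpha\phi\vdash\alpha\psi$. (The polymodal provability logic $\mathsf{GLP}$ is conservative over $\mathsf{RC}$,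 so equivalently $\mathsf{GLP}\vdash\phi\to\psi$.) Worms: $\mathbb W$ is the least class containing $\top$ and closed under $A\mapsto\langle\alpha\rangle A$ for each ordinal $\alpha$. $A<_\xi B$ iff $B\vdash\langle\xi\rangle A$. The relation $<_\xi$ is well-founded on $\mathbb W$, and $o_\xi(A):=\sup_{B<_\xi A}(o_\xi(B)+1)$ (with $\sup\varnothing=0$, $B$ ranging over $\mathbb W$). Hyperexponentials: $e(\xi):=-1+\omega^\xi$, a normal (strictly increasing, continuous) function. A weak hyperation of a normal function $f$ is a family of normal functions $\langle g^\xi\rangle_{\xi\in\mathsf{On}}$ with $g^0$ the identity, $g^1=f$, and $g^{\xi+\zeta}=g^\xi\circ g^\zeta$; the hyperation $\langle f^\xi\rangle$ of $f$ is the weak hyperation that is pointwise minimal among all weak hyperations of $f$ (it exists). $\langle e^\xi\rangle_{\xi\in\mathsf{On}}$ denotes the hyperation of $e$. The Veblen progression based on $e$ is $\langle e_\xi\rangle_{\xi\in\mathsf{On}}$, with $e_0:=e$ and, for $\xi>0$, $e_\xi$ the normal function enumerating in increasing order the ordinals that are simultaneous fixpoints of all $e_\zeta$, $\zeta<\xi$. *)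

theory Defs
  imports Main
begin

section \<open>Ordinals\<close>

text \<open>
  HOL has no proper class of all ordinals.  Its role is played by an arbitrary well-ordered type
  that satisfies Replacement (the values of a function on a proper initial segment are
  bounded) and Infinity (there is a limit element): up to isomorphism, exactly the regular
  uncountable cardinals (the von Neumann ordinals below such a cardinal).  All ordinals, formulas,
  functions on ordinals and ordinal-indexed families range over one such type.
\<close>

class ordinals = wellorder +
  assumes replacement: "\<exists>b. \<forall>x<a. f x < b"
    and infinity: "\<exists>l. (\<exists>x. x < l) \<and> (\<forall>x<l. \<exists>y. x < y \<and> y < l)"

text \<open>
  Instances exist, and they contain every ordinal that HOL can represent: for any type
  \<open>'a\<close>, the ordinals below the successor cardinal of \<open>'a + nat\<close> form an instance, into which
  every well-order on \<open>'a\<close> embeds as a proper initial segment.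
\<close>

unbundle cardinal_syntax

abbreviation ordinal_rel :: "('a + nat) set rel" where
  "ordinal_rel \<equiv> cardSuc |UNIV :: ('a + nat) set|"

typedef 'a ordinal = "Field (ordinal_rel :: ('a + nat) set rel)"
  using Field_cardSuc_not_empty[OF card_of_Card_order] by blast

instantiation ordinal :: (type) linorder
begin

definition less_eq_ordinal :: "'a ordinal \<Rightarrow> 'a ordinal \<Rightarrow> bool" where
  "x \<le> y \<longleftrightarrow> (Rep_ordinal x, Rep_ordinal y) \<in> ordinal_rel"

definition less_ordinal :: "'a ordinal \<Rightarrow> 'a ordinal \<Rightarrow> bool" where
  "x < y \<longleftrightarrow> x \<le> y \<and> x \<noteq> (y :: 'a ordinal)"

instance
proof -
  have W: "Well_order (ordinal_rel :: ('a + nat) set rel)"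
    by (simp add: cardSuc_Well_order card_of_Card_order)
  have R: "refl_on (Field (ordinal_rel :: ('a + nat) set rel)) ordinal_rel"
    and T: "trans (ordinal_rel :: ('a + nat) set rel)"
    and A: "antisym (ordinal_rel :: ('a + nat) set rel)"
    and L: "total_on (Field (ordinal_rel :: ('a + nat) set rel)) ordinal_rel"
    using W by (auto simp: order_on_defs)
  have anti: "x = y" if "x \<le> y" "y \<le> x" for x y :: "'a ordinal"
    using that A Rep_ordinal_inject by (metis less_eq_ordinal_def antisymD)
  show "OFCLASS('a ordinal, linorder_class)"
  proof (intro_classes)
    fix x y z :: "'a ordinal"
    show "x < y \<longleftrightarrow> x \<le> y \<and> \<not> y \<le> x"
      using anti by (auto simp: less_ordinal_def)
    show "x \<le> x"
      using R Rep_ordinal by (auto simp: less_eq_ordinal_def refl_on_def)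
    show "x \<le> y \<Longrightarrow> y \<le> z \<Longrightarrow> x \<le> z"
      using T by (auto simp: less_eq_ordinal_def dest: transD)
    show "x \<le> y \<Longrightarrow> y \<le> x \<Longrightarrow> x = y"
      by (rule anti)
    show "x \<le> y \<or> y \<le> x"
      using L R Rep_ordinal Rep_ordinal_inject unfolding less_eq_ordinal_def total_on_def refl_on_def
      by metis
  qed
qed

end

lemma ordinal_rel_iso:
  "(ordinal_rel :: ('a + nat) set rel) =o {(x, y :: 'a ordinal). x \<le> y}"
proof -
  have W: "Well_order (ordinal_rel :: ('a + nat) set rel)"
    by (simp add: cardSuc_Well_order card_of_Card_order)
  have inj: "inj_on Abs_ordinal (Field (ordinal_rel :: ('a + nat) set rel))"
    by (simp add: Abs_ordinal_inject inj_on_def)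
  have "dir_image (ordinal_rel :: ('a + nat) set rel) Abs_ordinal = {(x, y :: 'a ordinal). x \<le> y}"
    (is "?l = ?r")
  proof (intro set_eqI iffI)
    fix p assume "p \<in> ?l"
    then show "p \<in> ?r"
      by (auto simp: dir_image_def less_eq_ordinal_def Abs_ordinal_inverse FieldI1 FieldI2)
  next
    fix p assume "p \<in> ?r"
    then obtain x y where "p = (x, y)" "(Rep_ordinal x, Rep_ordinal y) \<in> ordinal_rel"
      by (auto simp: less_eq_ordinal_def)
    then show "p \<in> ?l"
      unfolding dir_image_def by (force simp: Rep_ordinal_inverse)
  qed
  with dir_image_ordIso[OF W inj] show ?thesis by simp
qed

instance ordinal :: (type) ordinals
proof
  let ?r = "ordinal_rel :: ('a + nat) set rel"
  let ?s = "{(x, y :: 'a ordinal). x \<le> y}"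
  have C: "Card_order ?r" by (simp add: cardSuc_Card_order card_of_Card_order)
  have inf: "infinite (UNIV :: ('a + nat) set)"
    by (simp add: finite_Plus_UNIV_iff)
  have reg: "regularCard ?r"
    by (rule infinite_cardSuc_regularCard) (use inf in \<open>simp_all add: Field_card_of card_of_card_order_on\<close>)
  have infF: "infinite (Field ?r)"
    using inf cardSuc_finite[OF card_of_Card_order, of "UNIV :: ('a + nat) set"] by (simp add: Field_card_of)
  have Cs: "Card_order ?s"
    using C ordinal_rel_iso Card_order_ordIso2 by blast
  have "Cinfinite ?r" using C infF by (simp add: cinfinite_def)
  then have regs: "regularCard ?s"
    using regularCard_ordIso[OF ordinal_rel_iso] reg by blast
  have Fs: "Field ?s = UNIV"
    by (auto simp: Field_def)
  have infs: "infinite (UNIV :: 'a ordinal set)"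
  proof -
    have "bij_betw Rep_ordinal (UNIV :: 'a ordinal set) (Field ?r)"
      by (metis (no_types, lifting) Rep_ordinal_inject bij_betw_def injI
          type_definition.Rep_range type_definition_ordinal)
    then show ?thesis using infF bij_betw_finite by blast
  qed
  have wfs: "wf {(x, y :: 'a ordinal). x < y}"
  proof -
    have "wf (?s - Id)" using Cs by (auto simp: card_order_on_def well_order_on_def)
    moreover have "?s - Id = {(x, y). x < y}" by auto
    ultimately show ?thesis by simp
  qed
  show "P a" if "\<And>x. (\<And>y. y < x \<Longrightarrow> P y) \<Longrightarrow> P x" for P and a :: "'a ordinal"
    using wf_induct_rule[OF wfs, of P a] that by auto
  show repl: "\<exists>b. \<forall>x<a. f x < b" for a and f :: "'a ordinal \<Rightarrow> 'a ordinal"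
  proof (rule ccontr)
    assume *: "\<nexists>b. \<forall>x<a. f x < b"
    have under: "underS ?s a = {..<a}" for a :: "'a ordinal"
      by (auto simp: underS_def)
    have lt: "|{..<a}| <o ?s"
      using card_of_underS[OF Cs, of a] by (simp add: under Fs)
    have noMax: "\<exists>c. b < c" for b :: "'a ordinal"
      using infinite_Card_order_limit[OF Cs, of b] infs unfolding Fs by (auto intro: le_neq_trans)
    have "cofinal (f ` {..<a}) ?s"
      unfolding cofinal_def Fs
    proof
      fix b :: "'a ordinal"
      obtain c where "b < c" using noMax by blast
      moreover obtain x where "x < a" "\<not> f x < c" using * by blast
      ultimately show "\<exists>y\<in>f ` {..<a}. b \<noteq> y \<and> (b, y) \<in> ?s" by force
    qed
    then have "|f ` {..<a}| =o ?s" using regs unfolding regularCard_def Fs by blast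
    then have "?s \<le>o |{..<a}|"
      using card_of_image ordIso_ordLeq_trans ordIso_symmetric by blast
    then show False using lt not_ordLess_ordLeq by blast
  qed
  show "\<exists>l::'a ordinal. (\<exists>x. x < l) \<and> (\<forall>x<l. \<exists>y. x < y \<and> y < l)"
  proof (rule ccontr)
    assume no: "\<not> ?thesis"
    have natlt: "|UNIV :: nat set| <o ?s"
    proof -
      have "|UNIV :: nat set| \<le>o |UNIV :: ('a + nat) set|"
        by (rule card_of_ordLeqI[of Inr]) auto
      then show ?thesis
        using cardSuc_greater[OF card_of_Card_order] ordinal_rel_iso
          ordLeq_ordLess_trans ordLess_ordIso_trans by blast
    qed
    have "\<exists>p. \<forall>y<x. \<forall>z. z < x \<longleftrightarrow> z \<le> p" for x :: "'a ordinal"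
      using no by (metis not_less order.strict_trans2 order.strict_trans1)
    then obtain pre where pre: "\<And>x y z :: 'a ordinal. y < x \<Longrightarrow> z < x \<longleftrightarrow> z \<le> pre x"
      by metis
    have fin: "finite {..<x}" for x :: "'a ordinal"
    proof (induction x rule: wf_induct_rule[OF wfs])
      case (1 x)
      show ?case
      proof (cases "\<exists>y. y < x")
        case True
        then have eq: "z < x \<longleftrightarrow> z \<le> pre x" for z using pre by blast
        then have "pre x < x" by blast
        moreover have "{..<x} = insert (pre x) {..<pre x}"
          using eq by (auto simp: order.order_iff_strict)
        ultimately show ?thesis using 1 by simp
      next
        case False
        then have "{..<x} = {}" by auto
        then show ?thesis by simp
      qed
    qed
    have "inj (\<lambda>x::'a ordinal. card {..<x})"
    proof (rule linorder_injI)
      fix x y :: "'a ordinal" assume "x < y"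
      then have "{..<x} \<subset> {..<y}" by auto
      then show "card {..<x} \<noteq> card {..<y}"
        using fin psubset_card_mono by (metis less_irrefl)
    qed
    then have "|UNIV :: 'a ordinal set| \<le>o |UNIV :: nat set|"
      by (intro card_of_ordLeqI) auto
    moreover have "?s =o |UNIV :: 'a ordinal set|"
      using Cs Fs card_of_Field_ordIso ordIso_symmetric by metis
    ultimately show False
      using natlt not_ordLess_ordLeq ordIso_ordLeq_trans by blast
  qed
qed

lemma well_order_ordLess_ordinal:
  fixes r :: "'a rel"
  assumes "Well_order r"
  shows "r <o {(x, y :: 'a ordinal). x \<le> y}"
proof -
  let ?r = "ordinal_rel :: ('a + nat) set rel"
  have "r <o ?r"
  proof (rule ccontr)
    assume "\<not> r <o ?r"
    then have "?r \<le>o r"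
      using assms by (simp add: cardSuc_Well_order card_of_Card_order not_ordLess_iff_ordLeq)
    then have "?r \<le>o |Field r|"
      by (metis (no_types, lifting) card_of_Card_order cardSuc_Card_order card_of_Field_ordIso
          card_of_mono2 ordIso_ordLeq_trans ordIso_symmetric)
    moreover have "|Field r| \<le>o |UNIV :: ('a + nat) set|"
      by (rule card_of_ordLeqI[of Inl]) auto
    ultimately have "?r \<le>o |UNIV :: ('a + nat) set|"
      by (rule ordLeq_transitive)
    then show False
      using cardSuc_greater[OF card_of_Card_order] not_ordLess_ordLeq by blast
  qed
  then show ?thesis using ordinal_rel_iso ordLess_ordIso_trans by blast
qed


unbundle no cardinal_syntax


section \<open>Ordinal arithmetic\<close>

text \<open>Total, and the least upper bound for bounded sets; the supremum of the empty set is zero.\<close>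

definition osup :: "'o::ordinals set \<Rightarrow> 'o" where
  "osup X = (LEAST b. \<forall>x\<in>X. x \<le> b)"

definition ozero :: "'o::ordinals" where
  "ozero = (LEAST x. True)"

definition osuc :: "'o::ordinals \<Rightarrow> 'o" where
  "osuc x = (LEAST y. x < y)"

definition oone :: "'o::ordinals" where
  "oone = osuc ozero"

definition is_limit :: "'o::ordinals \<Rightarrow> bool" where
  "is_limit l \<longleftrightarrow> l \<noteq> ozero \<and> (\<forall>x<l. osuc x < l)"

definition omega :: "'o::ordinals" where
  "omega = (LEAST l. is_limit l)"

text \<open>
  The zero, successor and limit clauses of the usual recursions are merged: for
  \<open>\<beta> > 0\<close>, \<open>\<alpha> + \<beta> = sup {(\<alpha> + \<gamma>) + 1 | \<gamma> < \<beta>}\<close>,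
  \<open>\<alpha> \<cdot> \<beta> = sup {\<alpha> \<cdot> \<gamma> + \<alpha> | \<gamma> < \<beta>}\<close> and
  \<open>\<omega>^\<beta> = sup {\<omega>^\<gamma> \<cdot> \<omega> | \<gamma> < \<beta>}\<close>.
\<close>

function oplus :: "'o::ordinals \<Rightarrow> 'o \<Rightarrow> 'o" (infixl "\<oplus>" 65) where
  "\<alpha> \<oplus> \<beta> = (if \<beta> = ozero then \<alpha> else osup ((\<lambda>\<gamma>. osuc (\<alpha> \<oplus> \<gamma>)) ` {..<\<beta>}))"
  by pat_completeness auto
termination
  by (relation "inv_image {(x, y). x < y} snd") (auto simp: wf)

declare oplus.simps [simp del]

function otimes :: "'o::ordinals \<Rightarrow> 'o \<Rightarrow> 'o" (infixl "\<otimes>" 70) where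
  "\<alpha> \<otimes> \<beta> = (if \<beta> = ozero then ozero else osup ((\<lambda>\<gamma>. \<alpha> \<otimes> \<gamma> \<oplus> \<alpha>) ` {..<\<beta>}))"
  by pat_completeness auto
termination
  by (relation "inv_image {(x, y). x < y} snd") (auto simp: wf)

declare otimes.simps [simp del]

function omega_pow :: "'o::ordinals \<Rightarrow> 'o" where
  "omega_pow \<beta> = (if \<beta> = ozero then oone else osup ((\<lambda>\<gamma>. omega_pow \<gamma> \<otimes> omega) ` {..<\<beta>}))"
  by pat_completeness auto
termination
  by (relation "{(x, y). x < y}") (auto simp: wf)

declare omega_pow.simps [simp del]

text \<open>\<open>lsub \<theta> \<zeta>\<close> is \<open>-\<theta> + \<zeta>\<close>, meaningful for \<open>\<theta> \<le> \<zeta>\<close>.\<close>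

definition lsub :: "'o::ordinals \<Rightarrow> 'o \<Rightarrow> 'o" where
  "lsub \<theta> \<zeta> = (THE \<eta>. \<theta> \<oplus> \<eta> = \<zeta>)"

definition last_exp :: "'o::ordinals \<Rightarrow> 'o" ("\<ell>") where
  "\<ell> \<eta> = (if \<eta> = ozero then ozero else (THE \<beta>. \<exists>\<alpha>. \<eta> = \<alpha> \<oplus> omega_pow \<beta>))"


section \<open>The Reflection Calculus and worms\<close>

datatype 'o rc = Top | Conj "'o rc" "'o rc" | Dia 'o "'o rc"

inductive rc_derives :: "'o::ordinals rc \<Rightarrow> 'o rc \<Rightarrow> bool" (infix "\<turnstile>" 50) where
  refl: "\<phi> \<turnstile> \<phi>"
| top: "\<phi> \<turnstile> Top"
| conj1: "Conj \<phi> \<psi> \<turnstile> \<phi>"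
| conj2: "Conj \<phi> \<psi> \<turnstile> \<psi>"
| trans4: "Dia \<alpha> (Dia \<alpha> \<phi>) \<turnstile> Dia \<alpha> \<phi>"
| mono: "\<alpha> < \<beta> \<Longrightarrow> Dia \<beta> \<phi> \<turnstile> Dia \<alpha> \<phi>"
| dia_conj: "\<alpha> < \<beta> \<Longrightarrow> Conj (Dia \<beta> \<phi>) (Dia \<alpha> \<psi>) \<turnstile> Dia \<beta> (Conj \<phi> (Dia \<alpha> \<psi>))"
| cut: "\<phi> \<turnstile> \<psi> \<Longrightarrow> \<psi> \<turnstile> \<chi> \<Longrightarrow> \<phi> \<turnstile> \<chi>"
| conjI: "\<phi> \<turnstile> \<psi> \<Longrightarrow> \<phi> \<turnstile> \<chi> \<Longrightarrow> \<phi> \<turnstile> Conj \<psi> \<chi>"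
| nec: "\<phi> \<turnstile> \<psi> \<Longrightarrow> Dia \<alpha> \<phi> \<turnstile> Dia \<alpha> \<psi>"

inductive_set worms :: "'o::ordinals rc set" where
  "Top \<in> worms"
| "A \<in> worms \<Longrightarrow> Dia \<alpha> A \<in> worms"

definition worm_less :: "'o::ordinals \<Rightarrow> 'o rc rel" where
  "worm_less \<xi> = {(A, B). A \<in> worms \<and> B \<in> worms \<and> B \<turnstile> Dia \<xi> A}"

text \<open>
  Well-founded recursion: since \<open>worm_less \<xi>\<close> is well-founded,
  \<open>worm_ord \<xi> A = sup {worm_ord \<xi> B + 1 | B <_\<xi> A}\<close>.
\<close>

definition worm_ord :: "'o::ordinals \<Rightarrow> 'o rc \<Rightarrow> 'o" where
  "worm_ord \<xi> = wfrec (worm_less \<xi>) (\<lambda>f A. osup ((\<lambda>B. osuc (f B)) ` {B. (B, A) \<in> worm_less \<xi>}))"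


section \<open>Hyperations and Veblen progressions\<close>

definition normal :: "('o::ordinals \<Rightarrow> 'o) \<Rightarrow> bool" where
  "normal f \<longleftrightarrow> strict_mono f \<and> (\<forall>l. is_limit l \<longrightarrow> f l = osup (f ` {..<l}))"

definition weak_hyperation :: "('o::ordinals \<Rightarrow> 'o) \<Rightarrow> ('o \<Rightarrow> 'o \<Rightarrow> 'o) \<Rightarrow> bool" where
  "weak_hyperation f g \<longleftrightarrow>
     (\<forall>\<xi>. normal (g \<xi>)) \<and> g ozero = id \<and> g oone = f \<and> (\<forall>\<xi> \<zeta>. g (\<xi> \<oplus> \<zeta>) = g \<xi> \<circ> g \<zeta>)"

text \<open>
  The pointwise minimal weak hyperation is unique by antisymmetry of \<open>\<le>\<close>; the value is the
  intended one only if it exists, as it does for normal \<open>f\<close>.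
\<close>

definition hyperation :: "('o::ordinals \<Rightarrow> 'o) \<Rightarrow> 'o \<Rightarrow> 'o \<Rightarrow> 'o" where
  "hyperation f = (THE g. weak_hyperation f g \<and>
     (\<forall>h. weak_hyperation f h \<longrightarrow> (\<forall>\<xi> x. g \<xi> x \<le> h \<xi> x)))"

text \<open>The increasing enumeration of an unbounded class.\<close>

definition enumeration :: "'o::ordinals set \<Rightarrow> 'o \<Rightarrow> 'o" where
  "enumeration X = (THE g. strict_mono g \<and> range g = X)"

function veblen :: "('o::ordinals \<Rightarrow> 'o) \<Rightarrow> 'o \<Rightarrow> 'o \<Rightarrow> 'o" where
  "veblen f \<xi> = (if \<xi> = ozero then f else enumeration {x. \<forall>\<zeta>\<in>{..<\<xi>}. veblen f \<zeta> x = x})"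
  by pat_completeness auto
termination
  by (relation "inv_image {(x, y). x < y} snd") (auto simp: wf)

declare veblen.simps [simp del]

definition hyperexp :: "'o::ordinals \<Rightarrow> 'o" where
  "hyperexp \<xi> = lsub oone (omega_pow \<xi>)"

end

theory Submission
  imports Defs
begin

text \<open>
  The ordinals form a Kripke model of \<open>RC\<close>: a point \<open>x\<close> is identified with the sequence of its
  iterated logarithms \<open>\<ell>\<^sup>\<xi>x\<close>, whose value at a limit \<open>\<zeta>\<close> is determined by
  \<open>\<ell>\<^sup>\<theta>x = e\<^bsup>-\<theta>+\<zeta>\<^esup>(\<ell>\<^sup>\<zeta>x)\<close> for all large \<open>\<theta> < \<zeta>\<close>, and \<open>x\<close> sees \<open>y\<close> along \<open>\<langle>\<xi>\<rangle>\<close> if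
  \<open>\<ell>\<^sup>\<eta>y < \<ell>\<^sup>\<eta>x\<close> for all \<open>\<eta> \<le> \<xi>\<close>.  A worm \<open>A\<close> is forced at a point \<open>val A\<close> that is least in all
  coordinates at once, so soundness makes \<open>A \<mapsto> \<ell>\<^sup>\<xi>(val A)\<close> strictly monotone for \<open><\<^sub>\<xi>\<close>.  Its values on
  the worms with modalities at least \<open>\<xi>\<close> are all ordinals, and these worms are compared by \<open><\<^sub>\<xi>\<close>;
  hence \<open>o\<^sub>\<xi>(A) = \<ell>\<^sup>\<xi>(val A)\<close>, and the theorem is the defining property of \<open>\<ell>\<^sup>\<zeta>\<close>.  The remaining
  equalities come from \<open>-\<theta>+\<zeta> = \<omega>\<^bsup>\<ell>\<zeta>\<^esup>\<close> for large \<open>\<theta>\<close>, and from the description of the hyperation as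
  the composition of Veblen functions along the Cantor normal form of its exponent.
\<close>

section \<open>Ordinal arithmetic\<close>

lemma ozero_le [simp]: "ozero \<le> (x::'o::ordinals)"
  unfolding ozero_def by (rule Least_le) simp

lemma not_less_ozero [simp]: "\<not> (x::'o::ordinals) < ozero"
  by (simp add: not_less)

lemma le_ozero_iff [simp]: "(x::'o::ordinals) \<le> ozero \<longleftrightarrow> x = ozero"
  by (simp add: antisym_conv)

lemma ozero_less_iff: "ozero < (x::'o::ordinals) \<longleftrightarrow> x \<noteq> ozero"
  by (simp add: order.strict_iff_order eq_commute)

lemma exists_greater: "\<exists>y::'o::ordinals. x < y"
proof -
  obtain a z :: 'o where "z < a" using infinity by blast
  then show ?thesis using replacement[of a "\<lambda>_. x"] by blast
qed

lemma less_osuc [simp]: "x < osuc (x::'o::ordinals)"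
  unfolding osuc_def using exists_greater by (rule LeastI_ex)

lemma osuc_le_iff: "osuc x \<le> y \<longleftrightarrow> (x::'o::ordinals) < y"
  by (metis less_osuc Least_le osuc_def order.strict_trans2)

lemma less_osuc_iff: "y < osuc x \<longleftrightarrow> y \<le> (x::'o::ordinals)"
  using osuc_le_iff by (metis not_le)

lemma osuc_mono [simp]: "osuc x < osuc y \<longleftrightarrow> x < (y::'o::ordinals)"
  by (simp add: less_osuc_iff osuc_le_iff)

lemma osuc_le_osuc [simp]: "osuc x \<le> osuc y \<longleftrightarrow> x \<le> (y::'o::ordinals)"
  by (simp add: less_osuc_iff osuc_le_iff)

lemma osuc_neq_ozero [simp]: "osuc x \<noteq> (ozero::'o::ordinals)"
  by (metis less_osuc not_less_ozero)

lemma ord_cases [case_names zero suc limit]: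
  fixes x :: "'o::ordinals"
  obtains "x = ozero" | y where "x = osuc y" | "is_limit x"
proof -
  have "\<exists>y. x = osuc y" if "x \<noteq> ozero" "\<not> is_limit x"
    using that unfolding is_limit_def by (metis osuc_le_iff not_less order.antisym)
  then show ?thesis using that by blast
qed

lemma is_limit_osuc: "is_limit l \<Longrightarrow> x < l \<Longrightarrow> osuc x < (l::'o::ordinals)"
  unfolding is_limit_def by blast

lemma not_is_limit_osuc [simp]: "\<not> is_limit (osuc (x::'o::ordinals))"
  unfolding is_limit_def by force

lemma is_limit_pos: "is_limit l \<Longrightarrow> ozero < (l::'o::ordinals)"
  unfolding is_limit_def by (simp add: ozero_less_iff)

lemma ord_induct [case_names zero suc limit]:
  fixes x :: "'o::ordinals"
  assumes "P ozero" "\<And>y. P y \<Longrightarrow> P (osuc y)" "\<And>l. is_limit l \<Longrightarrow> (\<And>y. y < l \<Longrightarrow> P y) \<Longrightarrow> P l"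
  shows "P x"
proof (induction x rule: less_induct)
  case (less x)
  then show ?case using assms by (cases x rule: ord_cases) auto
qed

section \<open>Suprema\<close>

lemma osup_least: "(\<And>x. x \<in> X \<Longrightarrow> x \<le> b) \<Longrightarrow> osup X \<le> (b::'o::ordinals)"
  unfolding osup_def by (rule Least_le) blast

lemma osup_upper:
  assumes "\<And>x. x \<in> X \<Longrightarrow> x \<le> (b::'o::ordinals)" "x \<in> X"
  shows "x \<le> osup X"
proof -
  have "\<forall>x\<in>X. x \<le> osup X" unfolding osup_def by (rule LeastI[of _ b]) (use assms in blast)
  then show ?thesis using assms by blast
qed

lemma image_bounded:
  fixes f :: "'o::ordinals \<Rightarrow> 'o"
  shows "\<exists>b. \<forall>x\<in>f ` {..<a}. x \<le> b"
  using replacement[of a f] by (auto intro: less_imp_le)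

lemma osup_image_upper:
  fixes f :: "'o::ordinals \<Rightarrow> 'o"
  shows "x < a \<Longrightarrow> f x \<le> osup (f ` {..<a})"
  using image_bounded[of f a] osup_upper[of "f ` {..<a}" _ "f x"] by blast

lemma osup_image_le_iff:
  fixes f :: "'o::ordinals \<Rightarrow> 'o"
  shows "osup (f ` {..<a}) \<le> z \<longleftrightarrow> (\<forall>x<a. f x \<le> z)"
  using osup_image_upper[of _ a f] by (auto intro!: osup_least intro: order.trans)

lemma less_osup_obtain:
  assumes "y < osup X" obtains x where "x \<in> X" "y < (x::'o::ordinals)"
  using assms osup_least[of X y] by (meson not_le)

section \<open>Addition and left subtraction\<close>

lemma oplus_ozero [simp]: "a \<oplus> ozero = (a::'o::ordinals)"
  by (simp add: oplus.simps)

text \<open>Upper bounds characterize a sum; comparing them replaces separate successor and limit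
  cases in the laws below.\<close>

lemma oplus_le_iff: "b \<noteq> ozero \<Longrightarrow> a \<oplus> b \<le> z \<longleftrightarrow> (\<forall>c<b. a \<oplus> c < (z::'o::ordinals))"
  by (subst oplus.simps) (simp add: osup_image_le_iff osuc_le_iff)

lemma oplus_strict_mono: "c < b \<Longrightarrow> a \<oplus> c < a \<oplus> (b::'o::ordinals)"
  using oplus_le_iff[of b a "a \<oplus> b"] by (metis order.refl not_less_ozero)

lemma oplus_less_iff [simp]: "a \<oplus> c < a \<oplus> b \<longleftrightarrow> c < (b::'o::ordinals)"
  by (metis oplus_strict_mono not_less_iff_gr_or_eq)

lemma oplus_left_le_iff [simp]: "a \<oplus> c \<le> a \<oplus> b \<longleftrightarrow> c \<le> (b::'o::ordinals)"
  by (metis oplus_less_iff not_less)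

lemma oplus_left_cancel [simp]: "a \<oplus> c = a \<oplus> b \<longleftrightarrow> c = (b::'o::ordinals)"
  by (metis oplus_less_iff not_less_iff_gr_or_eq)

lemma oplus_osuc: "a \<oplus> osuc b = osuc (a \<oplus> (b::'o::ordinals))"
proof (rule order.antisym)
  show "a \<oplus> osuc b \<le> osuc (a \<oplus> b)"
    by (simp add: oplus_le_iff less_osuc_iff)
qed (simp add: osuc_le_iff)

lemma ozero_oplus [simp]: "ozero \<oplus> b = (b::'o::ordinals)"
proof (induction b rule: less_induct)
  case (less b)
  show ?case
  proof (cases "b = ozero")
    case False
    have "ozero \<oplus> b \<le> z \<longleftrightarrow> b \<le> z" for z
      using oplus_le_iff[OF False, of ozero z] less by (auto intro: leI order.strict_trans2)
    then show ?thesis by (meson order.antisym order.refl)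
  qed simp
qed

lemma le_oplus_left [simp]: "a \<le> a \<oplus> (b::'o::ordinals)"
  using oplus_left_le_iff[of a ozero b] by simp

lemma oplus_eq_ozero [simp]: "a \<oplus> b = ozero \<longleftrightarrow> a = ozero \<and> b = (ozero::'o::ordinals)"
  by (metis le_oplus_left le_ozero_iff ozero_oplus)

lemma less_oplus_obtain:
  assumes "e < b \<oplus> c" "c \<noteq> (ozero::'o::ordinals)" obtains d where "d < c" "e \<le> b \<oplus> d"
  using assms oplus_le_iff[of c b e] by (meson not_le)

lemma oplus_assoc: "a \<oplus> b \<oplus> c = a \<oplus> (b \<oplus> (c::'o::ordinals))"
proof (induction c rule: less_induct)
  case (less c)
  show ?case
  proof (cases "c = ozero")
    case False
    have "(\<forall>d<c. a \<oplus> b \<oplus> d < z) \<longleftrightarrow> (\<forall>e<b \<oplus> c. a \<oplus> e < z)" for z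
    proof
      assume *: "\<forall>d<c. a \<oplus> b \<oplus> d < z"
      show "\<forall>e<b \<oplus> c. a \<oplus> e < z"
      proof (intro allI impI)
        fix e assume "e < b \<oplus> c"
        then obtain d where "d < c" "e \<le> b \<oplus> d" using less_oplus_obtain False by blast
        then show "a \<oplus> e < z" using * less by (metis oplus_left_le_iff order.strict_trans1)
      qed
    qed (use less in auto)
    then have "a \<oplus> b \<oplus> c \<le> z \<longleftrightarrow> a \<oplus> (b \<oplus> c) \<le> z" for z
      by (simp add: oplus_le_iff[of c] oplus_le_iff[of "b \<oplus> c"] False)
    then show ?thesis by (meson order.antisym order.refl)
  qed simp
qed

lemma oplus_mono_left: "a \<le> a' \<Longrightarrow> a \<oplus> b \<le> a' \<oplus> (b::'o::ordinals)"
proof (induction b rule: less_induct)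
  case (less b)
  then show ?case
    by (cases "b = ozero")
      (auto simp: oplus_le_iff intro: order.strict_trans1[OF _ oplus_strict_mono])
qed

lemma le_oplus_right [simp]: "b \<le> a \<oplus> (b::'o::ordinals)"
  using oplus_mono_left[of ozero a b] by simp

text \<open>The difference is the least \<open>h\<close> with \<open>z \<le> t \<oplus> h\<close>:
  sums with a smaller summand stay below \<open>z\<close>, so \<open>t \<oplus> h\<close> does not
  exceed it.\<close>

lemma oplus_lsub:
  assumes "t \<le> (z::'o::ordinals)" shows "t \<oplus> lsub t z = z"
proof -
  define h where "h = (LEAST h. z \<le> t \<oplus> h)"
  have ge: "z \<le> t \<oplus> h" unfolding h_def by (rule LeastI[of _ z]) simp
  have "t \<oplus> c < z" if "c < h" for c
    using not_less_Least that unfolding h_def by (meson not_le)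
  then have "t \<oplus> h \<le> z"
    using assms by (cases "h = ozero") (auto simp: oplus_le_iff)
  with ge have eq: "t \<oplus> h = z" by simp
  show ?thesis unfolding lsub_def by (rule theI[of _ h]) (use eq in auto)
qed

lemma lsub_oplus [simp]: "lsub t (t \<oplus> h) = (h::'o::ordinals)"
  using oplus_lsub[OF le_oplus_left, of t h] by simp

lemma le_obtain_oplus:
  assumes "t \<le> (z::'o::ordinals)" obtains h where "z = t \<oplus> h"
  using oplus_lsub[OF assms] by metis

lemma is_limit_oplus: "is_limit b \<Longrightarrow> is_limit (a \<oplus> (b::'o::ordinals))"
  unfolding is_limit_def
  by (metis less_oplus_obtain oplus_eq_ozero oplus_osuc oplus_less_iff osuc_le_osuc order.strict_trans1)

lemma oplus_oone [simp]: "a \<oplus> oone = osuc (a::'o::ordinals)"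
  by (simp add: oone_def oplus_osuc)

lemma oone_le_iff: "oone \<le> (x::'o::ordinals) \<longleftrightarrow> x \<noteq> ozero"
  by (simp add: oone_def osuc_le_iff ozero_less_iff)

lemma less_oone_iff: "(x::'o::ordinals) < oone \<longleftrightarrow> x = ozero"
  by (simp add: oone_def less_osuc_iff)

lemma oone_neq_ozero [simp]: "oone \<noteq> (ozero::'o::ordinals)"
  by (simp add: oone_def)

section \<open>The ordinal omega and multiplication\<close>

lemma is_limit_omega: "is_limit (omega::'o::ordinals)"
proof -
  obtain l x :: 'o where l: "x < l" "\<forall>x<l. \<exists>y. x < y \<and> y < l" using infinity by blast
  have "osuc y < l" if "y < l" for y
    using l(2) that by (metis osuc_le_iff order.strict_trans1)
  with l(1) have "is_limit l" unfolding is_limit_def by auto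
  then show ?thesis unfolding omega_def by (rule LeastI)
qed

lemma not_is_limit_less_omega: "n < (omega::'o::ordinals) \<Longrightarrow> \<not> is_limit n"
  unfolding omega_def by (rule not_less_Least)

lemma omega_induct [consumes 1, case_names zero suc]:
  assumes "n < (omega::'o::ordinals)" "P ozero" "\<And>m. m < omega \<Longrightarrow> P m \<Longrightarrow> P (osuc m)"
  shows "P n"
  using assms(1)
proof (induction n rule: less_induct)
  case (less n)
  show ?case
  proof (cases n rule: ord_cases)
    case (suc y)
    then have "y < n" by simp
    with less have "P y" "y < omega" by (meson less_trans)+
    then show ?thesis using assms(3) suc by blast
  qed (use less assms not_is_limit_less_omega in auto)
qed

lemma otimes_ozero [simp]: "a \<otimes> ozero = (ozero::'o::ordinals)"
  by (simp add: otimes.simps)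

lemma otimes_le_iff: "b \<noteq> ozero \<Longrightarrow> a \<otimes> b \<le> z \<longleftrightarrow> (\<forall>c<b. a \<otimes> c \<oplus> a \<le> (z::'o::ordinals))"
  by (subst otimes.simps) (simp add: osup_image_le_iff)

lemma otimes_upper: "c < b \<Longrightarrow> a \<otimes> c \<oplus> a \<le> a \<otimes> (b::'o::ordinals)"
  using otimes_le_iff[of b a "a \<otimes> b"] by (metis order.refl not_less_ozero)

lemma otimes_mono: "c \<le> b \<Longrightarrow> a \<otimes> c \<le> a \<otimes> (b::'o::ordinals)"
  by (metis otimes_upper le_oplus_left order.trans order.order_iff_strict)

lemma otimes_osuc: "a \<otimes> osuc b = a \<otimes> b \<oplus> (a::'o::ordinals)"
  by (rule order.antisym)
    (auto simp: otimes_le_iff less_osuc_iff otimes_upper intro: oplus_mono_left otimes_mono)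

lemma otimes_commutes_below_omega: "n < omega \<Longrightarrow> a \<oplus> a \<otimes> n = a \<otimes> n \<oplus> (a::'o::ordinals)"
  by (induction n rule: omega_induct) (auto simp: otimes_osuc oplus_assoc[symmetric])

text \<open>Since \<open>a\<close> commutes with its finite multiples, adding it on the left only
  moves each of them to the next; their supremum is unchanged.\<close>

lemma oplus_otimes_omega:
  assumes "(a::'o::ordinals) \<noteq> ozero" shows "a \<oplus> a \<otimes> omega = a \<otimes> omega"
proof (rule order.antisym)
  have w: "(omega::'o) \<noteq> ozero" using is_limit_omega is_limit_def by blast
  have "a \<otimes> ozero \<oplus> a \<le> a \<otimes> omega" by (rule otimes_upper) (simp add: w ozero_less_iff)
  then have nz: "a \<otimes> omega \<noteq> ozero" using assms by auto
  have "a \<oplus> e < a \<otimes> omega" if "e < a \<otimes> omega" for e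
  proof -
    obtain n where n: "n < omega" "e < a \<otimes> n \<oplus> a"
      using \<open>e < a \<otimes> omega\<close> otimes_le_iff[OF w, of a e] by (metis not_le)
    then have "e < a \<otimes> osuc n" by (simp add: otimes_osuc)
    then have "a \<oplus> e < a \<oplus> a \<otimes> osuc n" by simp
    also have "\<dots> = a \<otimes> osuc n \<oplus> a"
      using n is_limit_omega is_limit_osuc otimes_commutes_below_omega by blast
    also have "\<dots> \<le> a \<otimes> omega"
      using n is_limit_omega is_limit_osuc otimes_upper by blast
    finally show ?thesis .
  qed
  then show "a \<oplus> a \<otimes> omega \<le> a \<otimes> omega" using nz by (simp add: oplus_le_iff)
qed simp

section \<open>Powers of omega\<close>

lemma omega_pow_ozero [simp]: "omega_pow ozero = (oone::'o::ordinals)"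
  by (simp add: omega_pow.simps)

lemma omega_pow_le_iff:
  "b \<noteq> ozero \<Longrightarrow> omega_pow b \<le> z \<longleftrightarrow> (\<forall>c<b. omega_pow c \<otimes> omega \<le> (z::'o::ordinals))"
  by (subst omega_pow.simps) (simp add: osup_image_le_iff)

lemma omega_pow_upper: "c < b \<Longrightarrow> omega_pow c \<otimes> omega \<le> omega_pow (b::'o::ordinals)"
  using omega_pow_le_iff[of b "omega_pow b"] by (metis order.refl not_less_ozero)

lemma le_otimes_omega: "a \<le> a \<otimes> (omega::'o::ordinals)"
  using otimes_upper[OF is_limit_pos[OF is_limit_omega], of a] by simp

lemma omega_pow_neq_ozero [simp]: "omega_pow b \<noteq> (ozero::'o::ordinals)"
proof (cases "b = ozero")
  case False
  then have "oone \<otimes> omega \<le> omega_pow b"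
    using omega_pow_upper[of ozero b] by (simp add: ozero_less_iff)
  then show ?thesis
    using le_otimes_omega[of "oone::'o"] by (metis le_ozero_iff oone_neq_ozero)
qed simp

lemma omega_pow_pos [simp]: "(ozero::'o::ordinals) < omega_pow b"
  by (simp add: ozero_less_iff)

lemma omega_pow_less_otimes: "omega_pow b < omega_pow b \<otimes> (omega::'o::ordinals)"
proof -
  have "osuc ozero < (omega::'o)"
    using is_limit_omega is_limit_osuc is_limit_pos by blast
  then have "omega_pow b \<otimes> osuc ozero \<oplus> omega_pow b \<le> omega_pow b \<otimes> omega"
    by (rule otimes_upper)
  moreover have "omega_pow b < omega_pow b \<oplus> omega_pow b"
    using oplus_strict_mono[of ozero "omega_pow b" "omega_pow b"] by simp
  ultimately show ?thesis by (simp add: otimes_osuc)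
qed

lemma strict_mono_omega_pow: "strict_mono (omega_pow :: 'o::ordinals \<Rightarrow> 'o)"
  by (meson strict_monoI omega_pow_less_otimes omega_pow_upper order.strict_trans2)

lemmas omega_pow_less_iff [simp] = strict_mono_less[OF strict_mono_omega_pow]
lemmas omega_pow_mono_iff [simp] = strict_mono_less_eq[OF strict_mono_omega_pow]

lemma omega_pow_osuc: "omega_pow (osuc b) = omega_pow b \<otimes> (omega::'o::ordinals)"
proof (rule order.antisym)
  have "omega_pow c \<otimes> omega \<le> omega_pow b \<otimes> omega" if "c \<le> b" for c
    using that omega_pow_upper[of c b] le_otimes_omega[of "omega_pow b"]
    by (metis order.order_iff_strict order.trans order.refl)
  then show "omega_pow (osuc b) \<le> omega_pow b \<otimes> omega"
    by (simp add: omega_pow_le_iff less_osuc_iff)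
qed (simp add: omega_pow_upper)

lemma strict_mono_ge: "strict_mono f \<Longrightarrow> x \<le> f (x::'o::ordinals)"
proof (induction x rule: less_induct)
  case (less x)
  then show ?case by (metis not_le strict_mono_less)
qed

lemma normal_omega_pow: "normal (omega_pow :: 'o::ordinals \<Rightarrow> 'o)"
  unfolding normal_def
proof (intro HOL.conjI allI impI order.antisym)
  show "strict_mono (omega_pow :: 'o \<Rightarrow> 'o)" by (rule strict_mono_omega_pow)
  fix l :: 'o assume l: "is_limit l"
  then have "omega_pow c \<otimes> omega \<le> osup (omega_pow ` {..<l})" if "c < l" for c
    using that is_limit_osuc[OF l] osup_image_upper[of "osuc c" l omega_pow]
    by (simp add: omega_pow_osuc)
  then show "omega_pow l \<le> osup (omega_pow ` {..<l})"
    using l by (simp add: omega_pow_le_iff is_limit_def)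
  show "osup (omega_pow ` {..<l}) \<le> omega_pow l"
    by (simp add: osup_image_le_iff less_imp_le)
qed

section \<open>Absorption and Cantor normal form\<close>

lemma omega_pow_absorb_pow: "a < b \<Longrightarrow> omega_pow a \<oplus> omega_pow b = omega_pow (b::'o::ordinals)"
proof -
  assume "a < b"
  then have "omega_pow (osuc a) \<le> omega_pow b" by (simp add: osuc_le_iff)
  then obtain r where "omega_pow b = omega_pow (osuc a) \<oplus> r" by (rule le_obtain_oplus)
  then show ?thesis by (simp add: oplus_assoc[symmetric] omega_pow_osuc oplus_otimes_omega)
qed

lemma leading_term:
  assumes "(x::'o::ordinals) \<noteq> ozero"
  obtains a r where "x = omega_pow a \<oplus> r" "r < x" "x < omega_pow (osuc a)"
proof -
  \<comment> \<open>By continuity the first power exceeding \<open>x\<close> has a successor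
    exponent, whose predecessor is the leading exponent.\<close>
  define b where "b = (LEAST b. x < omega_pow b)"
  have "x < omega_pow (osuc x)"
    using strict_mono_ge[OF strict_mono_omega_pow, of "osuc x"] by (simp add: osuc_le_iff)
  then have b: "x < omega_pow b" unfolding b_def by (rule LeastI)
  have below: "omega_pow c \<le> x" if "c < b" for c
    using not_less_Least that unfolding b_def by (meson not_le)
  obtain a where a: "b = osuc a"
  proof (cases b rule: ord_cases)
    case zero
    then show ?thesis using b assms by (simp add: less_oone_iff)
  next
    case limit
    then have "omega_pow b \<le> x"
      using normal_omega_pow below unfolding normal_def by (metis osup_image_le_iff)
    then show ?thesis using b by simp
  qed
  have "omega_pow a \<le> x" using below a by simp
  then obtain r where r: "x = omega_pow a \<oplus> r" by (rule le_obtain_oplus)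
  \<comment> \<open>If \<open>r = x\<close>, then \<open>x\<close> absorbs
    \<open>omega_pow a\<close>, so it bounds all finite multiples of it and hence
    \<open>omega_pow (osuc a)\<close>.\<close>
  have "r \<noteq> x"
  proof
    assume "r = x"
    then have eq: "omega_pow a \<oplus> x = x" using r by simp
    have le: "omega_pow a \<otimes> n \<le> x" if "n < omega" for n
      using that
    proof (induction n rule: omega_induct)
      case (suc m)
      then show ?case
        using eq by (metis otimes_osuc otimes_commutes_below_omega oplus_left_le_iff)
    qed simp
    have "omega_pow a \<otimes> n \<oplus> omega_pow a \<le> x" if "n < omega" for n
      using le[of "osuc n"] that is_limit_omega is_limit_osuc otimes_osuc by metis
    then have "omega_pow a \<otimes> omega \<le> x"
      using is_limit_pos[OF is_limit_omega, where 'o = 'o]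
      by (simp add: otimes_le_iff ozero_less_iff)
    then show False using b a by (simp add: omega_pow_osuc)
  qed
  moreover have "r \<le> x" using r by simp
  ultimately have "r < x" by simp
  then show ?thesis using that[OF r] a b by simp
qed

text \<open>Along the normal form of \<open>x\<close>, the remainder is absorbed first, then the
  leading power.\<close>

lemma omega_pow_absorb: "x < omega_pow b \<Longrightarrow> x \<oplus> omega_pow b = omega_pow (b::'o::ordinals)"
proof (induction x rule: less_induct)
  case (less x)
  show ?case
  proof (cases "x = ozero")
    case False
    then obtain a r where x: "x = omega_pow a \<oplus> r" "r < x" by (rule leading_term)
    have "omega_pow a < omega_pow b" using x less.prems le_oplus_left order.strict_trans1 by blast
    then have "omega_pow a \<oplus> omega_pow b = omega_pow b" by (simp add: omega_pow_absorb_pow)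
    moreover have "r \<oplus> omega_pow b = omega_pow b" using less x by auto
    ultimately show ?thesis by (simp add: x oplus_assoc)
  qed simp
qed

lemma omega_pow_indecomposable:
  "x < omega_pow b \<Longrightarrow> y < omega_pow b \<Longrightarrow> x \<oplus> y < omega_pow (b::'o::ordinals)"
  by (metis omega_pow_absorb oplus_less_iff)

lemma last_term:
  "(x::'o::ordinals) \<noteq> ozero \<Longrightarrow> \<exists>a b. x = a \<oplus> omega_pow b"
proof (induction x rule: less_induct)
  case (less x)
  then obtain a r where x: "x = omega_pow a \<oplus> r" "r < x" using leading_term by blast
  show ?case
  proof (cases "r = ozero")
    case True
    then show ?thesis using x by (metis oplus_ozero ozero_oplus)
  next
    case False
    then show ?thesis using less.IH[OF x(2)] x(1) by (metis oplus_assoc)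
  qed
qed

text \<open>Cancelling the common initial part leaves either
  \<open>omega_pow b' \<le> omega_pow b\<close> or \<open>omega_pow b'\<close> as a sum of two
  smaller ordinals. This makes the exponent in \<open>last_exp\<close> unique.\<close>

lemma last_term_less_False:
  assumes "a \<oplus> omega_pow b = a' \<oplus> omega_pow b'" "b < (b'::'o::ordinals)" shows False
proof (cases "a \<le> a'")
  case True
  then obtain d where "a' = a \<oplus> d" by (rule le_obtain_oplus)
  then have "omega_pow b = d \<oplus> omega_pow b'" using assms by (simp add: oplus_assoc)
  then have "omega_pow b' \<le> omega_pow b" by simp
  then show False using assms(2) by (simp del: omega_pow_mono_iff add: omega_pow_mono_iff)
next
  case False
  then obtain d where d: "a = a' \<oplus> d" using le_obtain_oplus by (metis linear)
  then have eq: "d \<oplus> omega_pow b = omega_pow b'" using assms by (simp add: oplus_assoc)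
  have "d \<noteq> omega_pow b'"
    using eq oplus_left_cancel[of d "omega_pow b" ozero] by auto
  then have "d < omega_pow b'" using eq le_oplus_left[of d "omega_pow b"] by auto
  then have "d \<oplus> omega_pow b < omega_pow b'"
    by (rule omega_pow_indecomposable) (use assms in simp)
  then show False using eq by simp
qed

section \<open>The last exponent\<close>

lemma last_exp_ozero [simp]: "\<ell> ozero = (ozero::'o::ordinals)"
  by (simp add: last_exp_def)

lemma last_exp_oplus_omega_pow [simp]: "\<ell> (a \<oplus> omega_pow b) = (b::'o::ordinals)"
proof -
  have "(THE \<beta>. \<exists>\<alpha>. a \<oplus> omega_pow b = \<alpha> \<oplus> omega_pow \<beta>) = b"
    by (rule the_equality) (metis, metis last_term_less_False linorder_neq_iff)
  then show ?thesis by (simp add: last_exp_def)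
qed

lemma last_exp_omega_pow [simp]: "\<ell> (omega_pow b) = (b::'o::ordinals)"
  using last_exp_oplus_omega_pow[of ozero b] by simp

lemma last_exp_decomp:
  assumes "(x::'o::ordinals) \<noteq> ozero" obtains a where "x = a \<oplus> omega_pow (\<ell> x)"
  using last_term[OF assms] by auto

lemma omega_pow_last_exp_le: "(x::'o::ordinals) \<noteq> ozero \<Longrightarrow> omega_pow (\<ell> x) \<le> x"
  by (metis last_exp_decomp le_oplus_right)

lemma last_exp_oplus: "y \<noteq> ozero \<Longrightarrow> \<ell> (a \<oplus> y) = \<ell> (y::'o::ordinals)"
  by (metis last_exp_decomp last_exp_oplus_omega_pow oplus_assoc)

lemma last_exp_limit: "is_limit (x::'o::ordinals) \<Longrightarrow> \<ell> x \<noteq> ozero"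
  by (metis last_exp_decomp not_is_limit_osuc omega_pow_ozero oplus_oone is_limit_def)

text \<open>The last block \<open>omega_pow (\<ell> x)\<close> of \<open>x\<close> is not exhausted
  by two smaller summands. This gives room below limits and minimality of ordinals with a prescribed
  last exponent.\<close>

lemma oplus_omega_pow_less:
  assumes "m < x" "c < \<ell> (x::'o::ordinals)" shows "m \<oplus> omega_pow c < x"
proof -
  have "x \<noteq> ozero" using assms by auto
  then obtain a where a: "x = a \<oplus> omega_pow (\<ell> x)" by (rule last_exp_decomp)
  show ?thesis
  proof (cases "a \<le> m")
    case True
    then obtain d where d: "m = a \<oplus> d" by (rule le_obtain_oplus)
    then have "d < omega_pow (\<ell> x)" using assms a by (metis oplus_less_iff)
    then have "d \<oplus> omega_pow c < omega_pow (\<ell> x)"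
      using assms by (simp add: omega_pow_indecomposable)
    then show ?thesis using a d by (metis oplus_assoc oplus_less_iff)
  next
    case False
    then have "m \<oplus> omega_pow c \<le> a \<oplus> omega_pow c" by (simp add: oplus_mono_left)
    also have "\<dots> < a \<oplus> omega_pow (\<ell> x)" using assms by simp
    finally show ?thesis using a by simp
  qed
qed

text \<open>Such a \<open>y\<close> is \<open>d \<oplus> y'\<close> with \<open>y'\<close> positive
  and below \<open>omega_pow c\<close>, and the last exponent only sees \<open>y'\<close>.\<close>

lemma last_exp_between:
  assumes "d < y" "y < d \<oplus> omega_pow c" shows "\<ell> y < (c::'o::ordinals)"
proof -
  obtain y' where y': "y = d \<oplus> y'" using assms le_obtain_oplus less_imp_le by metis
  then have "y' \<noteq> ozero" "y' < omega_pow c" using assms by auto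
  then have "omega_pow (\<ell> y') < omega_pow c" using omega_pow_last_exp_le order.strict_trans1 by blast
  then show ?thesis using y' \<open>y' \<noteq> ozero\<close> by (simp add: last_exp_oplus)
qed

text \<open>A proper initial part of the last block is absorbed by that block. This is the second
  equality of the theorem.\<close>

lemma lsub_eventually:
  assumes "a \<le> t" "t < a \<oplus> omega_pow (r::'o::ordinals)"
  shows "lsub t (a \<oplus> omega_pow r) = omega_pow r"
proof -
  obtain d where d: "t = a \<oplus> d" using assms le_obtain_oplus by metis
  then have "t \<oplus> omega_pow r = a \<oplus> omega_pow r"
    using assms by (simp add: oplus_assoc omega_pow_absorb)
  then show ?thesis by (metis lsub_oplus)
qed

section \<open>Normal functions and enumerations\<close>

lemma normal_strict_mono: "normal f \<Longrightarrow> strict_mono f"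
  by (simp add: normal_def)

lemma normal_less_iff: "normal f \<Longrightarrow> f x < f y \<longleftrightarrow> x < (y::'o::ordinals)"
  by (simp add: normal_strict_mono strict_mono_less)

lemma normal_le_iff: "normal f \<Longrightarrow> f x \<le> f y \<longleftrightarrow> x \<le> (y::'o::ordinals)"
  by (simp add: normal_strict_mono strict_mono_less_eq)

lemma normal_eq_iff: "normal f \<Longrightarrow> f x = f y \<longleftrightarrow> x = (y::'o::ordinals)"
  by (simp add: normal_strict_mono strict_mono_eq)

lemma normal_ge: "normal f \<Longrightarrow> x \<le> f (x::'o::ordinals)"
  by (simp add: normal_strict_mono strict_mono_ge)

lemma normal_limit_le_iff:
  "normal f \<Longrightarrow> is_limit l \<Longrightarrow> f l \<le> z \<longleftrightarrow> (\<forall>x<l. f x \<le> (z::'o::ordinals))"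
  by (simp add: normal_def osup_image_le_iff)

lemma normalI:
  fixes f :: "'o::ordinals \<Rightarrow> 'o"
  assumes "strict_mono f" "\<And>l z. is_limit l \<Longrightarrow> (\<And>x. x < l \<Longrightarrow> f x \<le> z) \<Longrightarrow> f l \<le> z"
  shows "normal f"
  unfolding normal_def
proof (intro HOL.conjI allI impI order.antisym)
  fix l :: 'o assume "is_limit l"
  then show "f l \<le> osup (f ` {..<l})" by (rule assms(2)) (rule osup_image_upper)
  show "osup (f ` {..<l}) \<le> f l"
    using assms(1) by (simp add: osup_image_le_iff strict_mono_less_eq less_imp_le)
qed (fact assms(1))

lemma normal_id: "normal (id :: 'o::ordinals \<Rightarrow> 'o)"
proof (rule normalI)
  fix l z :: 'o assume "is_limit l" "\<And>x. x < l \<Longrightarrow> id x \<le> z"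
  then show "id l \<le> z" by (metis id_apply is_limit_osuc less_osuc not_le)
qed (simp add: strict_mono_def)

lemma normal_comp: "normal f \<Longrightarrow> normal g \<Longrightarrow> normal (f \<circ> g :: 'o::ordinals \<Rightarrow> 'o)"
proof (rule normalI)
  assume f: "normal f" and g: "normal g"
  show "strict_mono (f \<circ> g)"
    using f g by (simp add: strict_mono_def normal_less_iff)
  fix l z assume l: "is_limit l" and le: "\<And>x. x < l \<Longrightarrow> (f \<circ> g) x \<le> z"
  \<comment> \<open>The image of a limit is a limit: a successor value would be reached already
    below \<open>l\<close>.\<close>
  have "is_limit (g l)"
  proof (cases "g l" rule: ord_cases)
    case zero
    then show ?thesis using l normal_ge[OF g, of l] by (simp add: is_limit_def)
  next
    case (suc y)
    then have "\<not> g l \<le> y" by (simp add: not_le)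
    then obtain x where "x < l" "y < g x"
      using normal_limit_le_iff[OF g l] by (meson not_le)
    then have "g l \<le> g x" by (simp add: suc osuc_le_iff)
    then show ?thesis using \<open>x < l\<close> by (simp add: normal_le_iff[OF g])
  qed
  moreover have "f y \<le> z" if y: "y < g l" for y
  proof -
    obtain x where "x < l" "y < g x"
      using y normal_limit_le_iff[OF g l, of y] by (meson not_le)
    then have "f y \<le> f (g x)" by (simp add: normal_le_iff[OF f] less_imp_le)
    then show ?thesis using le[OF \<open>x < l\<close>] by simp
  qed
  ultimately show "(f \<circ> g) l \<le> z" by (simp add: normal_limit_le_iff[OF f])
qed

text \<open>Continuity for arbitrary bounded sets: a supremum outside \<open>S\<close> is a limit in
  which \<open>S\<close> is cofinal.\<close>

lemma normal_osup_le:
  fixes S :: "'o::ordinals set"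
  assumes f: "normal f" and S: "S \<noteq> {}" "\<And>s. s \<in> S \<Longrightarrow> s \<le> b"
    and le: "\<And>s. s \<in> S \<Longrightarrow> f s \<le> z"
  shows "f (osup S) \<le> z"
proof (cases "osup S \<in> S")
  case False
  have up: "s < osup S" if "s \<in> S" for s
    using osup_upper[of S b s] S that False by (metis order.order_iff_strict)
  have lim: "is_limit (osup S)"
  proof (cases "osup S" rule: ord_cases)
    case zero
    then show ?thesis using S up by fastforce
  next
    case (suc y)
    then show ?thesis using up less_osup_obtain[of y S] by (metis less_osuc less_osuc_iff not_le)
  qed
  have "f y \<le> z" if "y < osup S" for y
  proof -
    obtain s where "s \<in> S" "y < s" using less_osup_obtain \<open>y < osup S\<close> by blast
    then have "f y \<le> f s" by (simp add: normal_le_iff[OF f] less_imp_le)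
    then show ?thesis using le[OF \<open>s \<in> S\<close>] by simp
  qed
  then show ?thesis using normal_limit_le_iff[OF f lim] by blast
qed (rule le)

text \<open>Countable sets are bounded, since \<open>omega\<close> is a proper initial segment.\<close>

lemma sequence_bounded:
  fixes s :: "nat \<Rightarrow> 'o::ordinals"
  obtains b where "\<And>n. s n < b"
proof -
  define i where "i n = (osuc ^^ n) (ozero::'o)" for n
  have lt: "i n < omega" for n
    by (induction n) (auto simp: i_def is_limit_pos is_limit_osuc is_limit_omega)
  have "strict_mono i" by (rule strict_mono_Suc_iff[THEN iffD2]) (simp add: i_def)
  then have "inj i" by (rule strict_mono_imp_inj_on)
  obtain b where "\<forall>x<omega. s (inv i x) < b"
    using replacement[of omega "\<lambda>x. s (inv i x)"] by blast
  then have "s n < b" for n using lt[of n] inv_f_f[OF \<open>inj i\<close>] by metis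
  then show ?thesis by (rule that)
qed

section \<open>Enumeration of closed unbounded classes\<close>

text \<open>If \<open>h x = g y\<close>, every \<open>z < x\<close> satisfies
  \<open>g z \<le> h z < g y\<close>, hence \<open>x \<le> y\<close>. This serves for uniqueness of
  enumerations and for minimality of Veblen functions.\<close>

lemma strict_mono_range_subset_le:
  fixes g h :: "'o::ordinals \<Rightarrow> 'o"
  assumes "strict_mono g" "strict_mono h" "range h \<subseteq> range g"
  shows "g x \<le> h x"
proof (induction x rule: less_induct)
  case (less x)
  obtain y where y: "h x = g y" using assms(3) by blast
  have "z < y" if "z < x" for z
  proof -
    have "g z < g y" using less[OF that] that assms(2) y by (metis order.strict_trans1 strict_monoD)
    then show ?thesis using assms(1) by (simp add: strict_mono_less)
  qed
  then have "x \<le> y" by (metis less_irrefl not_le)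
  then show ?case using y assms(1) by (simp add: strict_mono_less_eq)
qed

text \<open>A recursive witness for the definite description in \<open>enumeration\<close>.\<close>

function enum_set :: "'o::ordinals set \<Rightarrow> 'o \<Rightarrow> 'o" where
  "enum_set X x = (LEAST y. y \<in> X \<and> (\<forall>z\<in>{..<x}. enum_set X z < y))"
  by pat_completeness auto
termination
  by (relation "inv_image {(x, y). x < y} snd") (auto simp: wf)

declare enum_set.simps [simp del]

lemma enumeration:
  fixes X :: "'o::ordinals set"
  assumes unb: "\<And>z. \<exists>x\<in>X. z < x"
  shows strict_mono_enumeration: "strict_mono (enumeration X)"
    and range_enumeration: "range (enumeration X) = X"
proof -
  let ?g = "enum_set X"
  have g: "?g x \<in> X \<and> (\<forall>z\<in>{..<x}. ?g z < ?g x)" for x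
  proof -
    obtain b where b: "\<forall>z<x. ?g z < b" using replacement by blast
    obtain y where "y \<in> X" "b < y" using unb by blast
    with b have ex: "\<exists>y. y \<in> X \<and> (\<forall>z\<in>{..<x}. ?g z < y)"
      by (intro exI[of _ y]) (auto intro: less_trans)
    show ?thesis using LeastI_ex[OF ex] unfolding enum_set.simps[of X x, symmetric] .
  qed
  have least: "?g x \<le> y" if "y \<in> X" "\<And>z. z < x \<Longrightarrow> ?g z < y" for x y
    by (subst enum_set.simps) (rule Least_le, use that in auto)
  have sm: "strict_mono ?g" using g by (intro strict_monoI) blast
  have "y \<in> range ?g" if "y \<in> X" for y
  proof -
    \<comment> \<open>The first index whose value reaches \<open>y\<close> has value
      \<open>y\<close>, as \<open>y\<close> is itself a candidate at that index.\<close>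
    define x where "x = (LEAST x. y \<le> ?g x)"
    have "y \<le> ?g x" unfolding x_def by (rule LeastI[of _ y]) (rule strict_mono_ge[OF sm])
    moreover have "?g z < y" if "z < x" for z
      using not_less_Least that unfolding x_def by (meson not_le)
    then have "?g x \<le> y" using least \<open>y \<in> X\<close> by blast
    ultimately show ?thesis by (metis order.antisym rangeI)
  qed
  then have "range ?g = X" using g by blast
  then have g': "strict_mono ?g \<and> range ?g = X" using sm by blast
  have "h = ?g" if h: "strict_mono h \<and> range h = X" for h
  proof
    fix x
    have "h x \<le> ?g x" by (rule strict_mono_range_subset_le) (use h g' in simp_all)
    moreover have "?g x \<le> h x" by (rule strict_mono_range_subset_le) (use h g' in simp_all)
    ultimately show "h x = ?g x" by (rule order.antisym)
  qed
  with g' have "enumeration X = ?g"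
    unfolding enumeration_def by (rule the_equality)
  with g' show "strict_mono (enumeration X)" "range (enumeration X) = X" by simp_all
qed

text \<open>Closure puts the supremum of the values below a limit \<open>l\<close> into the range;
  its index exceeds every \<open>x < l\<close>, so it is at least \<open>l\<close>.\<close>

lemma normal_enumeration:
  fixes X :: "'o::ordinals set"
  assumes unb: "\<And>z. \<exists>x\<in>X. z < x"
    and closed: "\<And>S b. S \<noteq> {} \<Longrightarrow> S \<subseteq> X \<Longrightarrow> (\<And>s. s \<in> S \<Longrightarrow> s \<le> b) \<Longrightarrow> osup S \<in> X"
  shows "normal (enumeration X)"
proof (rule normalI)
  note sm = strict_mono_enumeration[OF unb] and rg = range_enumeration[OF unb]
  show "strict_mono (enumeration X)" by (rule sm)
  fix l z assume l: "is_limit l" and le: "\<And>x. x < l \<Longrightarrow> enumeration X x \<le> z"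
  let ?s = "osup (enumeration X ` {..<l})"
  have "?s \<in> X"
    by (rule closed[of _ z]) (use rg l le is_limit_pos in auto)
  then obtain y where y: "?s = enumeration X y" using rg by blast
  have "x < y" if "x < l" for x
  proof -
    have "enumeration X x < enumeration X (osuc x)" using sm by (simp add: strict_mono_less)
    also have "\<dots> \<le> ?s" using that l by (simp add: osup_image_upper is_limit_osuc)
    finally show ?thesis using y sm by (simp add: strict_mono_less)
  qed
  then have "l \<le> y" by (metis less_irrefl not_le)
  then have "enumeration X l \<le> ?s" using y sm by (simp add: strict_mono_less_eq)
  also have "?s \<le> z" using le by (auto intro: osup_least)
  finally show "enumeration X l \<le> z" .
qed

section \<open>Veblen progressions and hyperations\<close>

lemma veblen_ozero [simp]: "veblen f ozero = f"
  by (simp add: veblen.simps)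

lemma common_fixpoints_unbounded:
  fixes F :: "'o::ordinals \<Rightarrow> 'o \<Rightarrow> 'o"
  assumes F: "\<And>\<sigma>. \<sigma> < \<rho> \<Longrightarrow> normal (F \<sigma>)"
  shows "\<exists>x\<in>{x. \<forall>\<sigma>\<in>{..<\<rho>}. F \<sigma> x = x}. z < x"
proof -
  \<comment> \<open>Each term dominates the images of the previous one under all
    \<open>F \<sigma>\<close> at once, so by continuity the supremum is a common fixpoint.\<close>
  define s where "s = rec_nat (osuc z) (\<lambda>_ x. max x (osup ((\<lambda>\<sigma>. F \<sigma> x) ` {..<\<rho>})))"
  have s0: "s 0 = osuc z" by (simp add: s_def)
  have step: "F \<sigma> (s n) \<le> s (Suc n)" if "\<sigma> < \<rho>" for \<sigma> n
    using osup_image_upper[OF that, of "\<lambda>\<sigma>. F \<sigma> (s n)"] by (simp add: s_def le_max_iff_disj)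
  obtain b where b: "\<And>n. s n < b" using sequence_bounded[of s] by blast
  let ?x = "osup (range s)"
  have up: "s n \<le> ?x" for n by (rule osup_upper[of _ b]) (use b less_imp_le in auto)
  have "F \<sigma> ?x \<le> ?x" if "\<sigma> < \<rho>" for \<sigma>
    by (rule normal_osup_le[OF F[OF that], of _ b])
      (use b less_imp_le step[OF that] up order.trans in blast)+
  then have "\<forall>\<sigma><\<rho>. F \<sigma> ?x = ?x" using normal_ge[OF F] by (meson order.antisym)
  moreover have "z < ?x" using up[of 0] s0 by (simp add: osuc_le_iff)
  ultimately show ?thesis by auto
qed

lemma common_fixpoints_closed:
  fixes F :: "'o::ordinals \<Rightarrow> 'o \<Rightarrow> 'o"
  assumes F: "\<And>\<sigma>. \<sigma> < \<rho> \<Longrightarrow> normal (F \<sigma>)"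
    and S: "S \<noteq> {}" "S \<subseteq> {x. \<forall>\<sigma>\<in>{..<\<rho>}. F \<sigma> x = x}" "\<And>s. s \<in> S \<Longrightarrow> s \<le> b"
  shows "osup S \<in> {x. \<forall>\<sigma>\<in>{..<\<rho>}. F \<sigma> x = x}"
proof -
  have "F \<sigma> (osup S) \<le> osup S" if "\<sigma> < \<rho>" for \<sigma>
  proof (rule normal_osup_le[OF F[OF that] S(1,3)])
    fix s assume "s \<in> S"
    then have "F \<sigma> s = s" using S(2) that by auto
    then show "F \<sigma> s \<le> osup S" using osup_upper[OF S(3)] \<open>s \<in> S\<close> by simp
  qed
  then show ?thesis using normal_ge[OF F] by (auto intro: order.antisym)
qed

lemma normal_veblen:
  fixes f :: "'o::ordinals \<Rightarrow> 'o"
  assumes "normal f" shows "normal (veblen f \<rho>)"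
proof (induction \<rho> rule: less_induct)
  case (less \<rho>)
  show ?case
  proof (cases "\<rho> = ozero")
    case False
    have "normal (enumeration {x. \<forall>\<sigma>\<in>{..<\<rho>}. veblen f \<sigma> x = x})"
      using less
      by (intro normal_enumeration common_fixpoints_unbounded common_fixpoints_closed)
    then show ?thesis
      using False by (subst veblen.simps) simp
  qed (simp add: assms)
qed

lemma range_veblen:
  fixes f :: "'o::ordinals \<Rightarrow> 'o"
  assumes "normal f" "\<rho> \<noteq> ozero"
  shows "range (veblen f \<rho>) = {x. \<forall>\<sigma><\<rho>. veblen f \<sigma> x = x}"
proof -
  have "range (veblen f \<rho>) = {x. \<forall>\<sigma>\<in>{..<\<rho>}. veblen f \<sigma> x = x}"
    using range_enumeration[OF common_fixpoints_unbounded[OF normal_veblen[OF assms(1)]], of \<rho>]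
      assms(2)
    by (subst veblen.simps) simp
  then show ?thesis by auto
qed

lemma veblen_veblen:
  fixes f :: "'o::ordinals \<Rightarrow> 'o"
  assumes "normal f" "\<sigma> < \<rho>"
  shows "veblen f \<sigma> (veblen f \<rho> x) = veblen f \<rho> x"
proof -
  have "\<rho> \<noteq> ozero" using assms by auto
  then show ?thesis using range_veblen[OF assms(1), of \<rho>] assms(2) by auto
qed

section \<open>The hyperation along Cantor normal form\<close>

text \<open>The leading exponent; the clause \<open>r < x\<close> lets \<open>hyp\<close> recurse on
  the remainder.\<close>

definition lead :: "'o::ordinals \<Rightarrow> 'o" where
  "lead x = (SOME a. \<exists>r<x. x = omega_pow a \<oplus> r \<and> x < omega_pow (osuc a))"

lemma lead:
  assumes "(x::'o::ordinals) \<noteq> ozero"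
  shows "\<exists>r<x. x = omega_pow (lead x) \<oplus> r \<and> x < omega_pow (osuc (lead x))"
proof -
  have "\<exists>a. \<exists>r<x. x = omega_pow a \<oplus> r \<and> x < omega_pow (osuc a)"
    using leading_term[OF assms] by blast
  then show ?thesis unfolding lead_def by (rule someI_ex)
qed

lemma lead_rest_less:
  assumes "(x::'o::ordinals) \<noteq> ozero" shows "lsub (omega_pow (lead x)) x < x"
proof -
  obtain r where r: "r < x" "x = omega_pow (lead x) \<oplus> r" using lead[OF assms] by blast
  then have "lsub (omega_pow (lead x)) x = r" using lsub_oplus[of "omega_pow (lead x)" r] by simp
  then show ?thesis using r by simp
qed

lemma lead_eqI: "omega_pow a \<le> x \<Longrightarrow> x < omega_pow (osuc a) \<Longrightarrow> lead x = (a::'o::ordinals)"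
proof -
  assume a: "omega_pow a \<le> x" "x < omega_pow (osuc a)"
  then have "x \<noteq> ozero" by auto
  from lead[OF this] obtain r
    where "x = omega_pow (lead x) \<oplus> r" and lt: "x < omega_pow (osuc (lead x))" by blast
  then have "omega_pow (lead x) \<le> x" using le_oplus_left by metis
  with lt a have "omega_pow a < omega_pow (osuc (lead x))" "omega_pow (lead x) < omega_pow (osuc a)"
    by (meson order.strict_trans1)+
  then show ?thesis by (simp add: less_osuc_iff)
qed

text \<open>
  The value at \<open>\<omega>\<^bsup>\<rho>\<^esup>\<close> has to be \<open>veblen f \<rho>\<close>, so the hyperation is the composition of Veblen
  functions along the Cantor normal form of the exponent.
\<close>

function hyp :: "('o::ordinals \<Rightarrow> 'o) \<Rightarrow> 'o \<Rightarrow> 'o \<Rightarrow> 'o" where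
  "hyp f \<xi> = (if \<xi> = ozero then id else veblen f (lead \<xi>) \<circ> hyp f (lsub (omega_pow (lead \<xi>)) \<xi>))"
  by pat_completeness auto
termination
  by (relation "inv_image {(x, y). x < y} snd") (auto simp: wf lead_rest_less)

declare hyp.simps [simp del]

lemma hyp_ozero [simp]: "hyp f ozero = id"
  by (simp add: hyp.simps)

lemma normal_hyp: "normal f \<Longrightarrow> normal (hyp f \<xi>)"
proof (induction \<xi> rule: less_induct)
  case (less \<xi>)
  then show ?case
    by (subst hyp.simps) (auto simp: normal_id lead_rest_less intro!: normal_comp normal_veblen)
qed

text \<open>Either \<open>omega_pow a\<close> is the leading term of the sum and the recursion
  unfolds, or \<open>\<zeta>\<close> absorbs it; then \<open>veblen f a\<close> likewise fixes every
  value of \<open>veblen f (lead \<zeta>)\<close>.\<close>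

lemma hyp_omega_pow_oplus:
  fixes f :: "'o::ordinals \<Rightarrow> 'o"
  assumes f: "normal f"
  shows "hyp f (omega_pow a \<oplus> \<zeta>) = veblen f a \<circ> hyp f \<zeta>"
proof (cases "\<zeta> < omega_pow (osuc a)")
  case True
  then have "omega_pow a \<oplus> \<zeta> < omega_pow (osuc a)"
    by (simp add: omega_pow_indecomposable)
  then have "lead (omega_pow a \<oplus> \<zeta>) = a" by (intro lead_eqI) auto
  then show ?thesis by (subst hyp.simps) simp
next
  case False
  then have nz: "\<zeta> \<noteq> ozero" by auto
  obtain r where r: "\<zeta> = omega_pow (lead \<zeta>) \<oplus> r" "\<zeta> < omega_pow (osuc (lead \<zeta>))"
    using lead[OF nz] by blast
  with False have "omega_pow (osuc a) < omega_pow (osuc (lead \<zeta>))" by (meson not_le order.strict_trans1)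
  then have less: "a < lead \<zeta>" by simp
  then have "omega_pow a \<oplus> \<zeta> = \<zeta>"
    using r(1) omega_pow_absorb_pow by (metis oplus_assoc)
  moreover have "veblen f a \<circ> hyp f \<zeta> = hyp f \<zeta>"
    using nz by (subst (1 2) hyp.simps) (auto simp: veblen_veblen[OF f less])
  ultimately show ?thesis by simp
qed

lemma hyp_oplus:
  fixes f :: "'o::ordinals \<Rightarrow> 'o"
  assumes f: "normal f"
  shows "hyp f (\<xi> \<oplus> \<zeta>) = hyp f \<xi> \<circ> hyp f \<zeta>"
proof (induction \<xi> rule: less_induct)
  case (less \<xi>)
  show ?case
  proof (cases "\<xi> = ozero")
    case False
    then obtain a r where r: "\<xi> = omega_pow a \<oplus> r" "r < \<xi>" by (rule leading_term)
    have "hyp f (\<xi> \<oplus> \<zeta>) = veblen f a \<circ> (hyp f r \<circ> hyp f \<zeta>)"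
      unfolding r(1) oplus_assoc hyp_omega_pow_oplus[OF f] less[OF r(2)] ..
    also have "\<dots> = hyp f \<xi> \<circ> hyp f \<zeta>"
      by (simp add: r(1) hyp_omega_pow_oplus[OF f] comp_assoc)
    finally show ?thesis .
  qed simp
qed

lemma hyp_omega_pow: "normal f \<Longrightarrow> hyp f (omega_pow \<rho>) = veblen f \<rho>"
  using hyp_omega_pow_oplus[of f \<rho> ozero] by simp

lemma weak_hyperation_hyp: "normal f \<Longrightarrow> weak_hyperation f (hyp f)"
  using hyp_omega_pow[of f ozero] by (simp add: weak_hyperation_def normal_hyp hyp_oplus)

section \<open>Minimality among weak hyperations\<close>

text \<open>For \<open>\<sigma> < \<rho>\<close>, absorption of exponents makes the values of
  \<open>h (omega_pow \<rho>)\<close> fixpoints of \<open>h (omega_pow \<sigma>)\<close>, hence of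
  \<open>veblen f \<sigma>\<close>, which it dominates. They thus lie in the range of
  \<open>veblen f \<rho>\<close>, the enumeration of all such fixpoints.\<close>

lemma weak_hyperation_ge_veblen:
  fixes f :: "'o::ordinals \<Rightarrow> 'o"
  assumes f: "normal f" and h: "weak_hyperation f h"
  shows "veblen f \<rho> x \<le> h (omega_pow \<rho>) x"
proof (induction \<rho> arbitrary: x rule: less_induct)
  case (less \<rho>)
  show ?case
  proof (cases "\<rho> = ozero")
    case True
    then show ?thesis using h by (simp add: weak_hyperation_def)
  next
    case False
    have "h (omega_pow \<rho>) y \<in> range (veblen f \<rho>)" for y
    proof -
      have "veblen f \<sigma> (h (omega_pow \<rho>) y) = h (omega_pow \<rho>) y" if "\<sigma> < \<rho>" for \<sigma>
      proof (rule order.antisym)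
        have "h (omega_pow \<sigma>) (h (omega_pow \<rho>) y) = h (omega_pow \<rho>) y"
          using h omega_pow_absorb_pow[OF that] unfolding weak_hyperation_def by (metis comp_apply)
        then show "veblen f \<sigma> (h (omega_pow \<rho>) y) \<le> h (omega_pow \<rho>) y"
          using less[OF that] by metis
      qed (rule normal_ge[OF normal_veblen[OF f]])
      then show ?thesis by (simp add: range_veblen[OF f False])
    qed
    moreover have "strict_mono (h (omega_pow \<rho>))"
      using h by (simp add: weak_hyperation_def normal_strict_mono)
    ultimately show ?thesis
      by (intro strict_mono_range_subset_le) (auto simp: normal_strict_mono normal_veblen f)
  qed
qed

lemma hyp_minimal:
  fixes f :: "'o::ordinals \<Rightarrow> 'o"
  assumes f: "normal f" and h: "weak_hyperation f h"
  shows "hyp f \<xi> x \<le> h \<xi> x"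
proof (induction \<xi> arbitrary: x rule: less_induct)
  case (less \<xi>)
  show ?case
  proof (cases "\<xi> = ozero")
    case True
    then show ?thesis using h by (simp add: weak_hyperation_def)
  next
    case False
    then obtain a r where r: "\<xi> = omega_pow a \<oplus> r" "r < \<xi>" by (rule leading_term)
    have "hyp f \<xi> x = veblen f a (hyp f r x)" by (simp add: r(1) hyp_omega_pow_oplus[OF f])
    also have "\<dots> \<le> veblen f a (h r x)"
      using less[OF r(2)] by (simp add: normal_le_iff normal_veblen f)
    also have "\<dots> \<le> h (omega_pow a) (h r x)" by (rule weak_hyperation_ge_veblen[OF f h])
    also have "\<dots> = h \<xi> x" using h unfolding weak_hyperation_def r(1) by simp
    finally show ?thesis .
  qed
qed

lemma hyperation_eq_hyp:
  fixes f :: "'o::ordinals \<Rightarrow> 'o"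
  assumes f: "normal f" shows "hyperation f = hyp f"
  unfolding hyperation_def
proof (rule the_equality)
  show "weak_hyperation f (hyp f) \<and> (\<forall>h. weak_hyperation f h \<longrightarrow> (\<forall>\<xi> x. hyp f \<xi> x \<le> h \<xi> x))"
    using weak_hyperation_hyp[OF f] hyp_minimal[OF f] by blast
next
  fix g assume "weak_hyperation f g \<and> (\<forall>h. weak_hyperation f h \<longrightarrow> (\<forall>\<xi> x. g \<xi> x \<le> h \<xi> x))"
  then show "g = hyp f"
    using weak_hyperation_hyp[OF f] hyp_minimal[OF f] by (intro ext) (meson order.antisym)
qed

lemma hyperation_omega_pow: "normal f \<Longrightarrow> hyperation f (omega_pow \<rho>) = veblen f \<rho>"
  by (simp add: hyperation_eq_hyp hyp_omega_pow)

section \<open>Hyperexponentials\<close>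

text \<open>A power with nonzero exponent absorbs \<open>oone\<close> on the left, so the
  subtraction changes only the value at \<open>ozero\<close>.\<close>

lemma hyperexp_eq: "hyperexp x = (if x = ozero then ozero else omega_pow (x::'o::ordinals))"
proof (cases "x = ozero")
  case True
  then show ?thesis using lsub_oplus[of oone ozero] by (simp add: hyperexp_def)
next
  case False
  then have "omega_pow ozero < omega_pow x" unfolding omega_pow_less_iff by (simp add: ozero_less_iff)
  then have "oone \<oplus> omega_pow x = omega_pow x" by (simp add: omega_pow_absorb)
  then have "lsub oone (omega_pow x) = omega_pow x" using lsub_oplus[of oone "omega_pow x"] by simp
  then show ?thesis using False by (simp add: hyperexp_def)
qed

lemma normal_hyperexp: "normal (hyperexp :: 'o::ordinals \<Rightarrow> 'o)"
proof (rule normalI)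
  show "strict_mono (hyperexp :: 'o \<Rightarrow> 'o)"
    by (auto simp: strict_mono_def hyperexp_eq)
  fix l z :: 'o assume l: "is_limit l" and le: "\<And>x. x < l \<Longrightarrow> hyperexp x \<le> z"
  have "omega_pow x \<le> z" if "x < l" for x
  proof -
    have "omega_pow x \<le> omega_pow (osuc x)" by (simp add: less_imp_le)
    also have "\<dots> \<le> z" using le[of "osuc x"] is_limit_osuc[OF l that] by (simp add: hyperexp_eq)
    finally show ?thesis .
  qed
  then show "hyperexp l \<le> z"
    using l by (simp add: hyperexp_eq is_limit_def normal_limit_le_iff[OF normal_omega_pow l])
qed

abbreviation (input) E :: "'o::ordinals \<Rightarrow> 'o \<Rightarrow> 'o" where
  "E \<equiv> hyperation hyperexp"

lemma weak_hyperation_E: "weak_hyperation hyperexp (E :: 'o::ordinals \<Rightarrow> 'o \<Rightarrow> 'o)"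
  by (simp add: hyperation_eq_hyp normal_hyperexp weak_hyperation_hyp)

lemma normal_E: "normal (E \<xi>)"
  using weak_hyperation_E unfolding weak_hyperation_def by blast

lemma E_ozero [simp]: "E ozero x = (x::'o::ordinals)"
  using weak_hyperation_E[where 'o = 'o] unfolding weak_hyperation_def by simp

lemma E_oone [simp]: "E oone = hyperexp"
  using weak_hyperation_E unfolding weak_hyperation_def by blast

lemma E_oplus: "E (\<xi> \<oplus> \<zeta>) x = E \<xi> (E \<zeta> (x::'o::ordinals))"
  using weak_hyperation_E[where 'o = 'o] unfolding weak_hyperation_def by (metis comp_apply)

lemmas E_less_iff [simp] = normal_less_iff[OF normal_E]
lemmas E_le_iff [simp] = normal_le_iff[OF normal_E]
lemmas E_eq_iff [simp] = normal_eq_iff[OF normal_E]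
lemmas E_ge [simp] = normal_ge[OF normal_E]

lemma E_osuc: "E (osuc \<xi>) x = E \<xi> (hyperexp x)"
  using E_oplus[of \<xi> oone x] by simp

lemma last_exp_hyperexp [simp]: "\<ell> (hyperexp x) = x"
  by (simp add: hyperexp_eq)

lemma hyperexp_last_exp_le: "hyperexp (\<ell> x) \<le> x"
  by (cases "x = ozero") (simp_all add: hyperexp_eq omega_pow_last_exp_le)

lemma last_exp_le: "\<ell> x \<le> (x::'o::ordinals)"
  by (rule order.trans[OF normal_ge[OF normal_hyperexp] hyperexp_last_exp_le])

text \<open>The hyperexponential is unbounded in its exponent; the fixpoint \<open>0\<close> forces the base point \<open>1\<close>.\<close>

lemma le_E_oone: "\<xi> \<le> E \<xi> (oone::'o::ordinals)"
proof -
  have gt: "oone < E d (oone::'o)" if "d \<noteq> ozero" for d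
  proof -
    have "oone \<le> d" using that by (simp add: oone_le_iff)
    then obtain d' where d: "d = oone \<oplus> d'" by (rule le_obtain_oplus)
    have "(oone::'o) < hyperexp oone"
      using strict_mono_less[OF strict_mono_omega_pow, of ozero "oone::'o"]
      by (simp add: hyperexp_eq ozero_less_iff)
    also have "\<dots> \<le> hyperexp (E d' oone)" by (simp add: normal_le_iff[OF normal_hyperexp])
    also have "\<dots> = E d oone" by (simp add: d E_oplus)
    finally show ?thesis .
  qed
  have "strict_mono (\<lambda>\<xi>. E \<xi> (oone::'o))"
  proof (rule strict_monoI)
    fix a b :: 'o assume "a < b"
    then obtain d where d: "b = a \<oplus> d" using le_obtain_oplus[OF less_imp_le] by blast
    with \<open>a < b\<close> have "d \<noteq> ozero" by auto
    then show "E a (oone::'o) < E b oone" by (simp add: d E_oplus gt)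
  qed
  then show ?thesis by (rule strict_mono_ge)
qed

section \<open>Iterated logarithms\<close>

text \<open>
  At a limit \<open>\<lambda>\<close>, the decreasing sequence \<open>hlog \<eta> x\<close>, \<open>\<eta> < \<lambda>\<close>, is eventually constant, and its
  eventual value is a fixpoint of enough hyperexponentials to have a preimage under
  \<open>E (-\<eta> + \<lambda>)\<close>; this preimage is taken as the value at \<open>\<lambda>\<close>.
\<close>

definition opred :: "'o::ordinals \<Rightarrow> 'o" where
  "opred x = (LEAST y. x \<le> osuc y)"

lemma opred_osuc [simp]: "opred (osuc x) = x"
  unfolding opred_def by (rule Least_equality) auto

lemma opred_less: "x \<noteq> ozero \<Longrightarrow> \<not> is_limit x \<Longrightarrow> opred x < x"
  by (cases x rule: ord_cases) auto

function hlog :: "'o::ordinals \<Rightarrow> 'o \<Rightarrow> 'o" where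
  "hlog \<xi> x =
     (if \<xi> = ozero then x
      else if is_limit \<xi>
        then SOME u. \<exists>\<theta>\<in>{..<\<xi>}. \<forall>\<eta>\<in>{..<\<xi>}. \<theta> \<le> \<eta> \<longrightarrow> hlog \<eta> x = E (lsub \<eta> \<xi>) u
      else \<ell> (hlog (opred \<xi>) x))"
  by pat_completeness auto
termination
  by (relation "inv_image {(x, y). x < y} fst") (auto simp: wf opred_less)

declare hlog.simps [simp del]

lemma hlog_ozero [simp]: "hlog ozero x = x"
  by (simp add: hlog.simps)

lemma hlog_osuc: "hlog (osuc \<xi>) x = \<ell> (hlog \<xi> x)"
  by (subst hlog.simps) simp

text \<open>The hypothesis \<open>ge\<close> is \<open>hlog_ge\<close> below \<open>\<xi>\<close>;
  it is isolated because the induction for \<open>hlog_ge\<close> uses this lemma at limits.\<close>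

lemma hlog_limit_if_ge_below:
  fixes \<xi> :: "'o::ordinals"
  assumes lim: "is_limit \<xi>"
    and ge: "\<And>\<eta> \<delta>. \<eta> \<oplus> \<delta> < \<xi> \<Longrightarrow> E \<delta> (hlog (\<eta> \<oplus> \<delta>) x) \<le> hlog \<eta> x"
  shows "\<exists>\<theta><\<xi>. \<forall>\<eta><\<xi>. \<theta> \<le> \<eta> \<longrightarrow> hlog \<eta> x = E (lsub \<eta> \<xi>) (hlog \<xi> x)"
proof -
  define \<rho> where "\<rho> = \<ell> \<xi>"
  have nz: "\<xi> \<noteq> ozero" using lim by (simp add: is_limit_def)
  obtain a where a: "\<xi> = a \<oplus> omega_pow \<rho>" unfolding \<rho>_def using last_exp_decomp[OF nz] by blast
  have "\<rho> \<noteq> ozero" unfolding \<rho>_def using lim by (rule last_exp_limit)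
  have "a < \<xi>" using oplus_strict_mono[of ozero "omega_pow \<rho>" a] a by simp
  \<comment> \<open>The least value on the final block from \<open>a\<close> on, where every
    \<open>lsub \<eta> \<xi>\<close> equals \<open>omega_pow \<rho>\<close>. Once attained it
    persists, since by \<open>ge\<close> the logarithms never increase.\<close>
  define c where "c = (LEAST c. \<exists>\<eta>. a \<le> \<eta> \<and> \<eta> < \<xi> \<and> c = hlog \<eta> x)"
  have "\<exists>\<eta>. a \<le> \<eta> \<and> \<eta> < \<xi> \<and> c = hlog \<eta> x"
    unfolding c_def by (rule LeastI[of _ "hlog a x"]) (use \<open>a < \<xi>\<close> in blast)
  then obtain \<theta> where th: "a \<le> \<theta>" "\<theta> < \<xi>" "hlog \<theta> x = c" by blast
  have min: "c \<le> hlog \<eta> x" if "a \<le> \<eta>" "\<eta> < \<xi>" for \<eta>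
    unfolding c_def by (rule Least_le) (use that in blast)
  have const: "hlog \<eta> x = c" if "\<theta> \<le> \<eta>" "\<eta> < \<xi>" for \<eta>
  proof (rule order.antisym)
    obtain d where d: "\<eta> = \<theta> \<oplus> d" using le_obtain_oplus[OF \<open>\<theta> \<le> \<eta>\<close>] by blast
    have "hlog \<eta> x \<le> E d (hlog \<eta> x)" by simp
    also have "\<dots> \<le> c" using ge[of \<theta> d] that th unfolding d by simp
    finally show "hlog \<eta> x \<le> c" .
    show "c \<le> hlog \<eta> x" by (rule min) (use that th in auto)
  qed
  \<comment> \<open>Going from \<open>\<theta>\<close> on by \<open>omega_pow \<sigma>\<close> stays
    below \<open>\<xi>\<close> and keeps the value \<open>c\<close>, so \<open>ge\<close> makes
    \<open>c\<close> a fixpoint. Holding for all \<open>\<sigma> < \<rho>\<close>, this puts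
    \<open>c\<close> in the range of \<open>veblen hyperexp \<rho>\<close>.\<close>
  have "E (omega_pow \<sigma>) c = c" if "\<sigma> < \<rho>" for \<sigma>
  proof (rule order.antisym)
    have lt: "\<theta> \<oplus> omega_pow \<sigma> < \<xi>"
      by (rule oplus_omega_pow_less) (use th that in \<open>simp_all add: \<rho>_def\<close>)
    then have "hlog (\<theta> \<oplus> omega_pow \<sigma>) x = c" by (simp add: const)
    then show "E (omega_pow \<sigma>) c \<le> c" using ge[OF lt] th by simp
  qed simp
  then have "c \<in> range (veblen hyperexp \<rho>)"
    by (simp add: range_veblen[OF normal_hyperexp \<open>\<rho> \<noteq> ozero\<close>] hyperation_omega_pow
        normal_hyperexp)
  then obtain u where u: "c = E (omega_pow \<rho>) u"
    by (auto simp: hyperation_omega_pow normal_hyperexp)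
  have "hlog \<eta> x = E (lsub \<eta> \<xi>) u" if "\<theta> \<le> \<eta>" "\<eta> < \<xi>" for \<eta>
  proof -
    have "lsub \<eta> \<xi> = omega_pow \<rho>"
      unfolding a by (rule lsub_eventually) (use that th a in auto)
    then show ?thesis using const[OF that] u by simp
  qed
  then have "\<exists>u. \<exists>\<theta>\<in>{..<\<xi>}. \<forall>\<eta>\<in>{..<\<xi>}. \<theta> \<le> \<eta> \<longrightarrow> hlog \<eta> x = E (lsub \<eta> \<xi>) u"
    using th by blast
  from someI_ex[OF this] show ?thesis
    using hlog.simps[of \<xi> x] lim nz by auto
qed

lemma hlog_ge: "E \<delta> (hlog (\<eta> \<oplus> \<delta>) x) \<le> hlog \<eta> (x::'o::ordinals)"
proof -
  have "\<forall>\<eta> \<delta>. \<eta> \<oplus> \<delta> = \<xi> \<longrightarrow> E \<delta> (hlog \<xi> x) \<le> hlog \<eta> x" for \<xi>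
  proof (induction \<xi> rule: less_induct)
    case (less \<xi>)
    show ?case
    proof (intro allI impI)
      fix \<eta> \<delta> assume eq: "\<eta> \<oplus> \<delta> = \<xi>"
      show "E \<delta> (hlog \<xi> x) \<le> hlog \<eta> x"
      proof (cases \<delta> rule: ord_cases)
        case zero
        then show ?thesis using eq by simp
      next
        case (suc d)
        then have xi: "\<xi> = osuc (\<eta> \<oplus> d)" using eq by (simp add: oplus_osuc)
        have "E \<delta> (hlog \<xi> x) = E d (hyperexp (\<ell> (hlog (\<eta> \<oplus> d) x)))"
          by (simp add: suc xi hlog_osuc E_osuc)
        also have "\<dots> \<le> E d (hlog (\<eta> \<oplus> d) x)" by (simp add: hyperexp_last_exp_le)
        also have "\<dots> \<le> hlog \<eta> x" using less[of "\<eta> \<oplus> d"] xi by simp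
        finally show ?thesis .
      next
        case limit
        then have lim: "is_limit \<xi>" using eq is_limit_oplus by blast
        obtain \<theta> where th: "\<theta> < \<xi>" "\<forall>\<eta><\<xi>. \<theta> \<le> \<eta> \<longrightarrow> hlog \<eta> x = E (lsub \<eta> \<xi>) (hlog \<xi> x)"
          using hlog_limit_if_ge_below[OF lim, of x] less by blast
        have "\<eta> < \<xi>" using eq oplus_strict_mono[of ozero \<delta> \<eta>] limit is_limit_pos by auto
        \<comment> \<open>A level past both \<open>\<eta>\<close> and the threshold splits
          \<open>\<delta>\<close> into a part handled by induction and a part given by the equation
          at the limit.\<close>
        define \<theta>' where "\<theta>' = max \<theta> \<eta>"
        have th': "\<theta>' < \<xi>" "\<theta> \<le> \<theta>'" "\<eta> \<le> \<theta>'" using th(1) \<open>\<eta> < \<xi>\<close> by (simp_all add: \<theta>'_def)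
        obtain d where d: "\<theta>' = \<eta> \<oplus> d" using le_obtain_oplus[OF th'(3)] by blast
        obtain d' where d': "\<xi> = \<theta>' \<oplus> d'" using le_obtain_oplus[OF less_imp_le[OF th'(1)]] by blast
        have "\<eta> \<oplus> \<delta> = \<eta> \<oplus> (d \<oplus> d')" by (simp add: eq d' d oplus_assoc)
        then have "E \<delta> (hlog \<xi> x) = E d (E d' (hlog \<xi> x))" by (simp add: E_oplus)
        also have "lsub \<theta>' \<xi> = d'" using lsub_oplus[of \<theta>' d'] d' by simp
        then have "E d (E d' (hlog \<xi> x)) = E d (hlog \<theta>' x)" using th(2) th' by simp
        also have "\<dots> \<le> hlog \<eta> x" using less[OF th'(1)] d by blast
        finally show ?thesis .
      qed
    qed
  qed
  then show ?thesis by blast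
qed

lemma hlog_limit:
  assumes "is_limit (\<xi>::'o::ordinals)"
  obtains \<theta> where "\<theta> < \<xi>" "\<And>\<eta>. \<theta> \<le> \<eta> \<Longrightarrow> \<eta> < \<xi> \<Longrightarrow> hlog \<eta> x = E (lsub \<eta> \<xi>) (hlog \<xi> x)"
  using hlog_limit_if_ge_below[OF assms hlog_ge, of x] by blast

lemma hlog_ge_lsub: "\<eta> \<le> \<xi> \<Longrightarrow> E (lsub \<eta> \<xi>) (hlog \<xi> x) \<le> hlog \<eta> (x::'o::ordinals)"
  using hlog_ge[of "lsub \<eta> \<xi>" \<eta> x] by (simp add: oplus_lsub)

text \<open>At a limit both points are, from some level on, exponentials with the same exponent, and
  \<open>E\<close> is injective in its argument.\<close>

lemma hlog_determined:
  assumes "hlog \<eta> x = hlog \<eta> y" "\<eta> \<le> (\<xi>::'o::ordinals)"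
  shows "hlog \<xi> x = hlog \<xi> y"
  using assms(2)
proof (induction \<xi> rule: less_induct)
  case (less \<xi>)
  show ?case
  proof (cases "\<eta> = \<xi>")
    case False
    with less.prems have lt: "\<eta> < \<xi>" by simp
    show ?thesis
    proof (cases \<xi> rule: ord_cases)
      case zero
      then show ?thesis using lt by simp
    next
      case (suc \<gamma>)
      then show ?thesis using less.IH[of \<gamma>] lt by (simp add: less_osuc_iff hlog_osuc)
    next
      case limit
      obtain \<theta>1 where t1: "\<theta>1 < \<xi>" "\<And>\<eta>. \<theta>1 \<le> \<eta> \<Longrightarrow> \<eta> < \<xi> \<Longrightarrow> hlog \<eta> x = E (lsub \<eta> \<xi>) (hlog \<xi> x)"
        using hlog_limit[OF limit] by blast
      obtain \<theta>2 where t2: "\<theta>2 < \<xi>" "\<And>\<eta>. \<theta>2 \<le> \<eta> \<Longrightarrow> \<eta> < \<xi> \<Longrightarrow> hlog \<eta> y = E (lsub \<eta> \<xi>) (hlog \<xi> y)"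
        using hlog_limit[OF limit] by blast
      define \<theta> where "\<theta> = max \<eta> (max \<theta>1 \<theta>2)"
      have th: "\<theta> < \<xi>" "\<eta> \<le> \<theta>" "\<theta>1 \<le> \<theta>" "\<theta>2 \<le> \<theta>" using t1(1) t2(1) lt by (simp_all add: \<theta>_def le_max_iff_disj)
      then have "hlog \<theta> x = hlog \<theta> y" using less.IH by blast
      then show ?thesis using t1(2)[OF th(3,1)] t2(2)[OF th(4,1)] by simp
    qed
  qed (use assms(1) in simp)
qed

text \<open>A successor step cancels one \<open>hyperexp\<close>. At a limit, induction cancels a
  large part \<open>d\<close> of \<open>\<delta>\<close>; the remaining exponential is compared with
  the one in \<open>hlog_limit\<close>.\<close>

lemma hlog_E:
  "hlog \<eta> x = E \<delta> u \<Longrightarrow> hlog (\<eta> \<oplus> \<delta>) x = (u::'o::ordinals)"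
proof (induction \<delta> arbitrary: u rule: ord_induct)
  case (suc \<delta>)
  then have "hlog (\<eta> \<oplus> \<delta>) x = hyperexp u" by (simp add: E_osuc)
  then show ?case by (simp add: oplus_osuc hlog_osuc)
next
  case (limit \<delta>)
  then have "is_limit (\<eta> \<oplus> \<delta>)" by (simp add: is_limit_oplus)
  from hlog_limit[OF this, of x] obtain \<theta> where th: "\<theta> < \<eta> \<oplus> \<delta>"
    "\<And>\<zeta>. \<theta> \<le> \<zeta> \<Longrightarrow> \<zeta> < \<eta> \<oplus> \<delta> \<Longrightarrow> hlog \<zeta> x = E (lsub \<zeta> (\<eta> \<oplus> \<delta>)) (hlog (\<eta> \<oplus> \<delta>) x)"
    by blast
  have "\<delta> \<noteq> ozero" using limit by (simp add: is_limit_def)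
  with th(1) obtain d where d: "d < \<delta>" "\<theta> \<le> \<eta> \<oplus> d" by (rule less_oplus_obtain)
  obtain d' where d': "\<delta> = d \<oplus> d'" using le_obtain_oplus[OF less_imp_le[OF d(1)]] by blast
  have "lsub (\<eta> \<oplus> d) (\<eta> \<oplus> \<delta>) = d'" unfolding d' oplus_assoc[symmetric] by simp
  moreover have "hlog (\<eta> \<oplus> d) x = E d' u"
    by (rule limit.IH[OF d(1)]) (use limit.prems in \<open>simp add: d' E_oplus\<close>)
  ultimately show ?case using th(2)[OF d(2)] d(1) by simp
qed simp

lemma hlog_E_between:
  assumes "hlog \<theta> x = E (lsub \<theta> \<xi>) u" "\<theta> \<le> \<eta>" "\<eta> \<le> (\<xi>::'o::ordinals)"
  shows "hlog \<eta> x = E (lsub \<eta> \<xi>) u"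
proof -
  obtain d where d: "\<eta> = \<theta> \<oplus> d" using le_obtain_oplus[OF assms(2)] by blast
  obtain d' where d': "\<xi> = \<eta> \<oplus> d'" using le_obtain_oplus[OF assms(3)] by blast
  have "\<xi> = \<theta> \<oplus> (d \<oplus> d')" using d d' by (simp add: oplus_assoc)
  then have "lsub \<theta> \<xi> = d \<oplus> d'" by simp
  moreover have "lsub \<eta> \<xi> = d'" using d' by simp
  ultimately show ?thesis using assms(1) hlog_E[of \<theta> x d "E d' u"] by (simp add: d E_oplus)
qed

lemma lsub_self [simp]: "lsub x x = (ozero::'o::ordinals)"
  using lsub_oplus[of x ozero] by simp

lemma lsub_ozero [simp]: "lsub ozero x = (x::'o::ordinals)"
  using lsub_oplus[of ozero x] by simp

lemma hlog_E_le: "\<eta> \<le> \<xi> \<Longrightarrow> hlog \<eta> (E \<xi> u) = E (lsub \<eta> \<xi>) (u::'o::ordinals)"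
  by (rule hlog_E_between[of ozero]) simp_all

lemma hlog_E_self [simp]: "hlog \<xi> (E \<xi> u) = (u::'o::ordinals)"
  using hlog_E_le[of \<xi> \<xi> u] by simp

lemma hlog_le: "hlog \<xi> x \<le> (x::'o::ordinals)"
  using order.trans[OF E_ge hlog_ge_lsub[of ozero \<xi> x]] by simp

lemma hlog_of_ozero [simp]: "hlog \<xi> ozero = (ozero::'o::ordinals)"
  using hlog_le[of \<xi> ozero] by simp

section \<open>A Kripke model of the Reflection Calculus on the ordinals\<close>

text \<open>
  Demanding a strict decrease at all \<open>\<eta> \<le> \<xi>\<close>, rather than agreement below \<open>\<xi>\<close> as in Ignatiev's model,
  makes monotonicity of the modalities immediate.
\<close>

definition acc :: "'o::ordinals \<Rightarrow> 'o \<Rightarrow> 'o \<Rightarrow> bool" where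
  "acc \<xi> x y \<longleftrightarrow> (\<forall>\<eta>\<le>\<xi>. hlog \<eta> y < hlog \<eta> x)"

text \<open>The demand at \<open>\<alpha>\<close> is converted into a least demand at an earlier
  level, where the induction hypothesis supplies the point. Two targets serve
  \<open>amalgamation\<close>.\<close>

lemma least_acc:
  fixes y z :: "'o::ordinals"
  assumes "hlog \<alpha> y < u" "hlog \<alpha> z < u"
  shows "\<exists>w. hlog \<alpha> w = u \<and> acc \<alpha> w y \<and> acc \<alpha> w z \<and>
    (\<forall>v. u \<le> hlog \<alpha> v \<longrightarrow> acc \<alpha> v y \<longrightarrow> acc \<alpha> v z \<longrightarrow> (\<forall>\<eta>\<le>\<alpha>. hlog \<eta> w \<le> hlog \<eta> v))"
  using assms
proof (induction \<alpha> arbitrary: u rule: ord_induct)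
  case zero
  then show ?case by (intro exI[of _ u]) (auto simp: acc_def)
next
  case (suc \<gamma>)
  define m where "m = max (hlog \<gamma> y) (hlog \<gamma> z)"
  define u' where "u' = (LEAST u'. m < u' \<and> u \<le> \<ell> u')"
  have "m < m \<oplus> omega_pow u" using oplus_strict_mono[of ozero "omega_pow u" m] by simp
  then have ex: "m < m \<oplus> omega_pow u \<and> u \<le> \<ell> (m \<oplus> omega_pow u)" by simp
  have "m < u' \<and> u \<le> \<ell> u'"
    unfolding u'_def using ex by (rule LeastI)
  then have u': "m < u'" "u \<le> \<ell> u'" by simp_all
  have least: "u' \<le> v" if "m < v" "u \<le> \<ell> v" for v
    unfolding u'_def by (rule Least_le) (use that in blast)
  \<comment> \<open>A larger last exponent would leave room for the smaller candidate
    \<open>m \<oplus> omega_pow u\<close>.\<close>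
  have "\<ell> u' = u"
  proof (rule ccontr)
    assume "\<ell> u' \<noteq> u"
    then have "u < \<ell> u'" using u'(2) by simp
    then have "m \<oplus> omega_pow u < u'" using u'(1) by (simp add: oplus_omega_pow_less)
    then show False using least ex by (meson not_le)
  qed
  have "hlog \<gamma> y < u'" "hlog \<gamma> z < u'" using u'(1) by (simp_all add: m_def)
  from suc.IH[OF this] obtain w where w: "hlog \<gamma> w = u'" "acc \<gamma> w y" "acc \<gamma> w z"
    "\<And>v \<eta>. u' \<le> hlog \<gamma> v \<Longrightarrow> acc \<gamma> v y \<Longrightarrow> acc \<gamma> v z \<Longrightarrow> \<eta> \<le> \<gamma> \<Longrightarrow> hlog \<eta> w \<le> hlog \<eta> v"
    by blast
  have le: "\<eta> \<le> osuc \<gamma> \<longleftrightarrow> \<eta> \<le> \<gamma> \<or> \<eta> = osuc \<gamma>" for \<eta>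
    using less_osuc_iff[of \<eta> \<gamma>] by (auto simp: order.order_iff_strict[of \<eta> "osuc \<gamma>"])
  have hw: "hlog (osuc \<gamma>) w = u" using w(1) \<open>\<ell> u' = u\<close> by (simp add: hlog_osuc)
  have accw: "acc (osuc \<gamma>) w y" "acc (osuc \<gamma>) w z"
    using w(2,3) suc.prems hw unfolding acc_def le by auto
  have "hlog \<eta> w \<le> hlog \<eta> v"
    if v: "u \<le> hlog (osuc \<gamma>) v" "acc (osuc \<gamma>) v y" "acc (osuc \<gamma>) v z" and "\<eta> \<le> osuc \<gamma>" for v \<eta>
  proof -
    have v': "acc \<gamma> v y" "acc \<gamma> v z" using v(2,3) unfolding acc_def le by auto
    then have "m < hlog \<gamma> v" by (simp add: m_def acc_def)
    then have "u' \<le> hlog \<gamma> v" using v(1) by (simp add: least hlog_osuc)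
    then show ?thesis using w(4) v' hw v(1) \<open>\<eta> \<le> osuc \<gamma>\<close> unfolding le by auto
  qed
  then show ?case using hw accw by blast
next
  case (limit \<alpha>)
  obtain \<theta>1 where t1: "\<theta>1 < \<alpha>" "\<And>\<eta>. \<theta>1 \<le> \<eta> \<Longrightarrow> \<eta> < \<alpha> \<Longrightarrow> hlog \<eta> y = E (lsub \<eta> \<alpha>) (hlog \<alpha> y)"
    using hlog_limit[OF limit(1)] by blast
  obtain \<theta>2 where t2: "\<theta>2 < \<alpha>" "\<And>\<eta>. \<theta>2 \<le> \<eta> \<Longrightarrow> \<eta> < \<alpha> \<Longrightarrow> hlog \<eta> z = E (lsub \<eta> \<alpha>) (hlog \<alpha> z)"
    using hlog_limit[OF limit(1)] by blast
  \<comment> \<open>From \<open>\<theta>\<close> on, \<open>y\<close> and \<open>z\<close> are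
    exponentials of their values at \<open>\<alpha>\<close>, so
    \<open>E (lsub \<eta> \<alpha>) u\<close> exceeds them at each such
    \<open>\<eta>\<close>.\<close>
  define \<theta> where "\<theta> = max \<theta>1 \<theta>2"
  have th: "\<theta> < \<alpha>" using t1 t2 by (simp add: \<theta>_def)
  have yz: "hlog \<eta> y < E (lsub \<eta> \<alpha>) u" "hlog \<eta> z < E (lsub \<eta> \<alpha>) u" if "\<theta> \<le> \<eta>" "\<eta> \<le> \<alpha>" for \<eta>
    using that t1(2)[of \<eta>] t2(2)[of \<eta>] limit.prems
    by (cases "\<eta> = \<alpha>"; simp add: \<theta>_def)+
  from limit.IH[OF th yz[OF order.refl less_imp_le[OF th]]] obtain w where w: "hlog \<theta> w = E (lsub \<theta> \<alpha>) u"
    "acc \<theta> w y" "acc \<theta> w z"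
    "\<And>v \<eta>. E (lsub \<theta> \<alpha>) u \<le> hlog \<theta> v \<Longrightarrow> acc \<theta> v y \<Longrightarrow> acc \<theta> v z \<Longrightarrow> \<eta> \<le> \<theta> \<Longrightarrow> hlog \<eta> w \<le> hlog \<eta> v"
    by blast
  have above: "hlog \<eta> w = E (lsub \<eta> \<alpha>) u" if "\<theta> \<le> \<eta>" "\<eta> \<le> \<alpha>" for \<eta>
    using hlog_E_between[OF w(1) that] .
  have hw: "hlog \<alpha> w = u" using above[of \<alpha>] th by simp
  have accw: "acc \<alpha> w y" "acc \<alpha> w z"
    using w(2,3) yz above unfolding acc_def by (metis linear)+
  have "hlog \<eta> w \<le> hlog \<eta> v"
    if v: "u \<le> hlog \<alpha> v" "acc \<alpha> v y" "acc \<alpha> v z" and "\<eta> \<le> \<alpha>" for v \<eta>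
  proof -
    have ge: "E (lsub \<zeta> \<alpha>) u \<le> hlog \<zeta> v" if "\<zeta> \<le> \<alpha>" for \<zeta>
      by (rule order.trans[OF _ hlog_ge_lsub[OF that]]) (simp add: v)
    show ?thesis
    proof (cases "\<eta> \<le> \<theta>")
      case True
      have "acc \<theta> v y" "acc \<theta> v z" using v(2,3) th unfolding acc_def by auto
      then show ?thesis using w(4) ge[of \<theta>] th True by simp
    next
      case False
      then show ?thesis using above[of \<eta>] ge[of \<eta>] \<open>\<eta> \<le> \<alpha>\<close> by simp
    qed
  qed
  then show ?case using hw accw by blast
qed

text \<open>The semantic counterpart of \<open>dia_conj\<close>: \<open>k\<close> is enlarged enough
  to see \<open>c\<close> along \<open>\<mu>\<close>, but so little that points seeing
  \<open>k\<close> along \<open>osuc \<mu>\<close> and \<open>c\<close> along \<open>\<mu>\<close>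
  still see the result along \<open>\<mu>\<close>.\<close>

lemma amalgamation:
  fixes k c :: "'o::ordinals"
  obtains w where "\<And>\<eta>. hlog \<eta> k \<le> hlog \<eta> w" "acc \<mu> w c" "\<And>\<eta>. \<mu> < \<eta> \<Longrightarrow> hlog \<eta> w = hlog \<eta> k"
    "\<And>v. acc (osuc \<mu>) v k \<Longrightarrow> acc \<mu> v c \<Longrightarrow> acc \<mu> v w"
proof -
  define m where "m = max (hlog \<mu> k) (hlog \<mu> c)"
  \<comment> \<open>The last exponent reproduces the coordinate of \<open>k\<close> at
    \<open>osuc \<mu>\<close>, and with it all later ones.\<close>
  define u where "u = m \<oplus> omega_pow (hlog (osuc \<mu>) k)"
  have "m < u" unfolding u_def using oplus_strict_mono[of ozero _ m] by simp
  then have lt: "hlog \<mu> k < u" "hlog \<mu> c < u" by (simp_all add: m_def)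
  obtain w where w: "hlog \<mu> w = u" "acc \<mu> w k" "acc \<mu> w c"
    "\<And>v \<eta>. u \<le> hlog \<mu> v \<Longrightarrow> acc \<mu> v k \<Longrightarrow> acc \<mu> v c \<Longrightarrow> \<eta> \<le> \<mu> \<Longrightarrow> hlog \<eta> w \<le> hlog \<eta> v"
    using least_acc[OF lt] by blast
  have "hlog (osuc \<mu>) w = hlog (osuc \<mu>) k" using w(1) by (simp add: hlog_osuc u_def)
  then have tail: "hlog \<eta> w = hlog \<eta> k" if "\<mu> < \<eta>" for \<eta>
    using hlog_determined that by (metis osuc_le_iff)
  have "hlog \<eta> k \<le> hlog \<eta> w" for \<eta>
    using w(2) tail[of \<eta>] by (cases "\<eta> \<le> \<mu>") (auto simp: acc_def less_imp_le)
  moreover have "acc \<mu> v w" if v: "acc (osuc \<mu>) v k" "acc \<mu> v c" for v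
  proof -
    have v': "acc \<mu> v k" using v(1) unfolding acc_def by (meson less_osuc less_imp_le order.trans)
    have "m < hlog \<mu> v" using v' v(2) by (simp add: m_def acc_def)
    moreover have "hlog (osuc \<mu>) k < \<ell> (hlog \<mu> v)"
      using v(1) unfolding acc_def hlog_osuc[symmetric] by blast
    ultimately have "u < hlog \<mu> v" unfolding u_def by (rule oplus_omega_pow_less)
    \<comment> \<open>Agreement at some \<open>\<eta> \<le> \<mu>\<close> would persist up to
      \<open>\<mu>\<close>, where the values differ; so the weak inequalities from minimality become
      strict.\<close>
    then have ne: "hlog \<eta> w \<noteq> hlog \<eta> v" if "\<eta> \<le> \<mu>" for \<eta>
      using hlog_determined[of \<eta> w v \<mu>] that w(1) by auto
    show ?thesis unfolding acc_def
      using w(4)[of v] v' v(2) \<open>u < hlog \<mu> v\<close> ne by (auto simp: order.strict_iff_order)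
  qed
  ultimately show ?thesis using that w(3) tail by blast
qed

section \<open>Forcing and soundness\<close>

primrec forces :: "'o::ordinals \<Rightarrow> 'o rc \<Rightarrow> bool" where
  "forces x Top \<longleftrightarrow> True"
| "forces x (Conj \<phi> \<psi>) \<longleftrightarrow> forces x \<phi> \<and> forces x \<psi>"
| "forces x (Dia \<alpha> \<phi>) \<longleftrightarrow> (\<exists>y. acc \<alpha> x y \<and> forces y \<phi>)"

lemma forces_upward:
  "forces x \<phi> \<Longrightarrow> (\<And>\<eta>. hlog \<eta> x \<le> hlog \<eta> y) \<Longrightarrow> forces y \<phi>"
  by (induction \<phi>) (auto simp: acc_def intro: order.strict_trans2)

lemma soundness: "\<phi> \<turnstile> \<psi> \<Longrightarrow> forces x \<phi> \<Longrightarrow> forces x \<psi>"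
proof (induction arbitrary: x rule: rc_derives.induct)
  case (trans4 \<alpha> \<phi>)
  then show ?case by (auto simp: acc_def) (meson less_trans)
next
  case (mono \<alpha> \<beta> \<phi>)
  then show ?case by (auto simp: acc_def) (meson less_imp_le order.trans)
next
  case (dia_conj \<alpha> \<beta> \<phi> \<psi>)
  then obtain y z where y: "acc \<beta> x y" "forces y \<phi>" and z: "acc \<alpha> x z" "forces z \<psi>" by auto
  \<comment> \<open>The enlargement \<open>w\<close> of \<open>y\<close> also sees \<open>z\<close>
    along \<open>\<alpha>\<close>, and \<open>x\<close> still sees it along
    \<open>\<beta>\<close>.\<close>
  obtain w where w: "\<And>\<eta>. hlog \<eta> y \<le> hlog \<eta> w" "acc \<alpha> w z" "\<And>\<eta>. \<alpha> < \<eta> \<Longrightarrow> hlog \<eta> w = hlog \<eta> y"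
    "\<And>v. acc (osuc \<alpha>) v y \<Longrightarrow> acc \<alpha> v z \<Longrightarrow> acc \<alpha> v w"
    using amalgamation[where k = y and c = z and \<mu> = \<alpha>] by metis
  have "forces w \<phi>" using y(2) w(1) by (rule forces_upward)
  moreover have "forces w (Dia \<alpha> \<psi>)" using w(2) z(2) by auto
  moreover have "acc \<beta> x w"
  proof -
    have "acc (osuc \<alpha>) x y"
      using y(1) dia_conj unfolding acc_def by (meson osuc_le_iff order.trans)
    then have "acc \<alpha> x w" using w(4) z(1) by blast
    then show ?thesis using w(3) y(1) unfolding acc_def by (metis not_le)
  qed
  ultimately show ?case by auto
qed auto

section \<open>Least forcing points\<close>

text \<open>Only the coordinate at \<open>ozero\<close> is minimized; for worms
  \<open>least_forcing\<close> makes this point least in every coordinate.\<close>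

definition val :: "'o::ordinals rc \<Rightarrow> 'o" where
  "val A = (LEAST x. forces x A)"

lemma least_forcing:
  "A \<in> worms \<Longrightarrow> \<exists>x. forces x A \<and> (\<forall>y. forces y A \<longrightarrow> (\<forall>\<eta>. hlog \<eta> x \<le> hlog \<eta> y))"
proof (induction rule: worms.induct)
  case 1
  show ?case by (intro exI[of _ ozero]) simp
next
  case (2 A \<alpha>)
  then obtain b where b: "forces b A" "\<And>y \<eta>. forces y A \<Longrightarrow> hlog \<eta> b \<le> hlog \<eta> y" by blast
  \<comment> \<open>The least admissible value at \<open>\<alpha>\<close> is this successor; its
    last exponent is \<open>ozero\<close>, so all later coordinates vanish.\<close>
  have "hlog \<alpha> b < osuc (hlog \<alpha> b)" by simp
  from least_acc[OF this this] obtain w where w: "hlog \<alpha> w = osuc (hlog \<alpha> b)" "acc \<alpha> w b"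
    "\<And>v \<eta>. osuc (hlog \<alpha> b) \<le> hlog \<alpha> v \<Longrightarrow> acc \<alpha> v b \<Longrightarrow> \<eta> \<le> \<alpha> \<Longrightarrow> hlog \<eta> w \<le> hlog \<eta> v"
    by blast
  have "osuc (hlog \<alpha> b) = hlog \<alpha> b \<oplus> omega_pow ozero" by simp
  then have "\<ell> (osuc (hlog \<alpha> b)) = ozero" using last_exp_oplus_omega_pow by metis
  then have "hlog (osuc \<alpha>) w = hlog (osuc \<alpha>) ozero" unfolding hlog_osuc[of \<alpha> w] w(1) by simp
  then have zero: "hlog \<eta> w = ozero" if "\<alpha> < \<eta>" for \<eta>
    using hlog_determined[of "osuc \<alpha>" w ozero \<eta>] that by (simp add: osuc_le_iff)
  have "hlog \<eta> w \<le> hlog \<eta> y" if y: "forces y (Dia \<alpha> A)" for y \<eta>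
  proof (cases "\<eta> \<le> \<alpha>")
    case True
    obtain z where z: "acc \<alpha> y z" "forces z A" using y by auto
    then have "acc \<alpha> y b" using b(2) unfolding acc_def by (meson order.strict_trans1)
    then show ?thesis using w(3) True by (simp add: acc_def osuc_le_iff)
  qed (simp add: zero not_le)
  moreover have "forces w (Dia \<alpha> A)" using w(2) b(1) by auto
  ultimately show ?case by blast
qed

lemma
  assumes "A \<in> worms"
  shows forces_val: "forces (val A) A"
    and hlog_val_le: "forces y A \<Longrightarrow> hlog \<eta> (val A) \<le> hlog \<eta> y"
proof -
  obtain x where x: "forces x A" "\<And>y \<eta>. forces y A \<Longrightarrow> hlog \<eta> x \<le> hlog \<eta> y"
    using least_forcing[OF assms] by blast
  have "val A = x"
    unfolding val_def by (rule Least_equality) (use x x(2)[of _ ozero] in auto)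
  then show "forces (val A) A" "forces y A \<Longrightarrow> hlog \<eta> (val A) \<le> hlog \<eta> y"
    using x by auto
qed

lemma forces_Dia_iff: "A \<in> worms \<Longrightarrow> forces x (Dia \<alpha> A) \<longleftrightarrow> acc \<alpha> x (val A)"
  using forces_val hlog_val_le unfolding forces.simps acc_def by (metis order.strict_trans1)

lemma forces_iff: "A \<in> worms \<Longrightarrow> forces x A \<longleftrightarrow> (\<forall>\<eta>. hlog \<eta> (val A) \<le> hlog \<eta> x)"
  using forces_val hlog_val_le forces_upward by blast

section \<open>Worms\<close>

primrec wge :: "'o::ordinals \<Rightarrow> 'o rc \<Rightarrow> bool" where
  "wge \<xi> Top \<longleftrightarrow> True"
| "wge \<xi> (Conj \<phi> \<psi>) \<longleftrightarrow> False"
| "wge \<xi> (Dia \<alpha> \<phi>) \<longleftrightarrow> \<xi> \<le> \<alpha> \<and> wge \<xi> \<phi>"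

lemma wge_worms: "wge \<xi> A \<Longrightarrow> A \<in> worms"
  by (induction A) (auto intro: worms.intros)

lemma worms_wge: "A \<in> worms \<Longrightarrow> wge ozero A"
  by (induction rule: worms.induct) auto

lemma wge_antimono: "wge \<xi> A \<Longrightarrow> \<zeta> \<le> \<xi> \<Longrightarrow> wge \<zeta> A"
  by (induction A) auto

text \<open>Junk value on conjunctions, which do not occur in worms.\<close>

primrec wcat :: "'o rc \<Rightarrow> 'o rc \<Rightarrow> 'o rc" where
  "wcat Top C = C"
| "wcat (Conj \<phi> \<psi>) C = C"
| "wcat (Dia \<alpha> A) C = Dia \<alpha> (wcat A C)"

lemma wge_wcat: "wge \<xi> A \<Longrightarrow> wge \<xi> C \<Longrightarrow> wge \<xi> (wcat A C)"
  by (induction A) auto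

lemma size_wcat: "wge \<xi> A \<Longrightarrow> size (wcat A C) = size A + size C"
  by (induction A) auto

declare rc_derives.cut [trans]

lemma Dia_antimono: "\<alpha> \<le> \<beta> \<Longrightarrow> Dia \<beta> \<phi> \<turnstile> Dia \<alpha> \<phi>"
  using rc_derives.mono rc_derives.refl by (cases "\<alpha> = \<beta>") auto

section \<open>Concatenation as conjunction\<close>

lemma wcat_left: "wge (osuc a) A \<Longrightarrow> wcat A C \<turnstile> A"
  by (induction A) (auto intro: rc_derives.intros)

lemma wcat_right: "wge (osuc a) A \<Longrightarrow> wcat A (Dia a C) \<turnstile> Dia a C"
proof (induction A)
  case (Dia b A)
  have "Dia b (wcat A (Dia a C)) \<turnstile> Dia b (Dia a C)" using Dia by (auto intro: rc_derives.nec)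
  also have "Dia b (Dia a C) \<turnstile> Dia a (Dia a C)" using Dia.prems by (simp add: osuc_le_iff rc_derives.mono)
  also have "Dia a (Dia a C) \<turnstile> Dia a C" by (rule rc_derives.trans4)
  finally show ?case by simp
qed (auto intro: rc_derives.refl)

text \<open>\<open>dia_conj\<close> carries \<open>Dia a C\<close> inward through the modalities of
  \<open>A\<close>, all larger than \<open>a\<close>. With \<open>wcat_left\<close> and
  \<open>wcat_right\<close>, concatenation amounts to conjunction.\<close>

lemma wcat_join: "wge (osuc a) A \<Longrightarrow> Conj A (Dia a C) \<turnstile> wcat A (Dia a C)"
proof (induction A)
  case (Dia b A)
  have "Conj (Dia b A) (Dia a C) \<turnstile> Dia b (Conj A (Dia a C))"
    using Dia.prems by (simp add: osuc_le_iff rc_derives.dia_conj)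
  also have "\<dots> \<turnstile> Dia b (wcat A (Dia a C))" using Dia by (auto intro: rc_derives.nec)
  finally show ?case by simp
qed (auto intro: rc_derives.intros)

section \<open>Decomposition and linearity\<close>

text \<open>The cut is made at the first modality below \<open>\<xi>\<close>.\<close>

lemma worm_split:
  "wge \<alpha> A \<Longrightarrow> wge \<xi> A \<or>
    (\<exists>h \<mu> C. wge \<xi> h \<and> \<alpha> \<le> \<mu> \<and> \<mu> < \<xi> \<and> wge \<alpha> C \<and> A = wcat h (Dia \<mu> C))"
proof (induction A)
  case (Dia \<beta> A)
  show ?case
  proof (cases "\<beta> < \<xi>")
    case True
    then show ?thesis
      using Dia.prems by (intro disjI2 exI[of _ Top] exI[of _ \<beta>] exI[of _ A]) auto
  next
    case False
    with Dia consider "wge \<xi> A"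
      | h \<mu> C where "wge \<xi> h" "\<alpha> \<le> \<mu>" "\<mu> < \<xi>" "wge \<alpha> C" "A = wcat h (Dia \<mu> C)" by auto
    then show ?thesis
    proof cases
      case 2
      then show ?thesis
        using False by (intro disjI2 exI[of _ "Dia \<beta> h"] exI[of _ \<mu>] exI[of _ C]) auto
    qed (use False in auto)
  qed
qed auto

text \<open>
  If the modalities of the worm \<open>X\<close> are at least \<open>a\<close>, then \<open>X\<close> is equivalent to the conjunction of a
  worm \<open>H\<close> with modalities above \<open>a\<close> and of \<open>\<langle>a\<rangle>Y\<close> for the at most one element \<open>Y\<close> of \<open>S\<close>.
\<close>

definition decomposes :: "'o::ordinals \<Rightarrow> 'o rc \<Rightarrow> 'o rc \<Rightarrow> 'o rc set \<Rightarrow> bool" where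
  "decomposes a X H S \<longleftrightarrow>
     wge (osuc a) H \<and> X \<turnstile> H \<and> size H \<le> size X \<and>
     (S \<noteq> {} \<longrightarrow> size H < size X) \<and> (S = {} \<longrightarrow> wge (osuc a) X) \<and>
     (\<forall>Y\<in>S. wge a Y \<and> size Y < size X \<and> X \<turnstile> Dia a Y) \<and>
     (\<forall>C. C \<turnstile> H \<longrightarrow> (\<forall>Y\<in>S. C \<turnstile> Dia a Y) \<longrightarrow> C \<turnstile> X) \<and>
     (\<forall>C. C \<turnstile> Dia (osuc a) H \<longrightarrow> (\<forall>Y\<in>S. C \<turnstile> Dia a Y) \<longrightarrow> C \<turnstile> Dia (osuc a) X)"

text \<open>The first modality below \<open>osuc a\<close> can only be \<open>a\<close>; the worm is
  cut there, and \<open>S\<close> is empty if there is none.\<close>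

lemma worm_decomposes:
  assumes "wge a X" shows "\<exists>H S. decomposes a X H S"
proof -
  consider "wge (osuc a) X"
    | h \<mu> Y where "wge (osuc a) h" "a \<le> \<mu>" "\<mu> < osuc a" "wge a Y" "X = wcat h (Dia \<mu> Y)"
    using worm_split[OF assms] by blast
  then show ?thesis
  proof cases
    case 1
    then show ?thesis
      by (intro exI[of _ X] exI[of _ "{}"]) (simp add: decomposes_def rc_derives.refl)
  next
    case 2
    then have "\<mu> = a" by (simp add: less_osuc_iff)
    then have X: "X = wcat h (Dia a Y)" using 2 by simp
    have join: "C \<turnstile> X" if "C \<turnstile> h" "C \<turnstile> Dia a Y" for C
      unfolding X by (rule rc_derives.cut[OF rc_derives.conjI[OF that] wcat_join[OF 2(1)]])
    have join': "C \<turnstile> Dia (osuc a) X" if "C \<turnstile> Dia (osuc a) h" "C \<turnstile> Dia a Y" for C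
    proof -
      have "C \<turnstile> Conj (Dia (osuc a) h) (Dia a Y)" using that by (rule rc_derives.conjI)
      also have "\<dots> \<turnstile> Dia (osuc a) (Conj h (Dia a Y))" by (rule rc_derives.dia_conj) simp
      also have "\<dots> \<turnstile> Dia (osuc a) X" unfolding X by (rule rc_derives.nec[OF wcat_join[OF 2(1)]])
      finally show ?thesis .
    qed
    have "X \<turnstile> h" unfolding X using 2(1) by (rule wcat_left)
    moreover have "X \<turnstile> Dia a Y" unfolding X using 2(1) by (rule wcat_right)
    moreover have "size X = size h + size Y + 1" using 2(1) by (simp add: X size_wcat)
    ultimately show ?thesis
      using 2 join join' by (intro exI[of _ h] exI[of _ "{Y}"]) (simp add: decomposes_def)
  qed
qed

lemma least_modality:
  "wge \<alpha> A \<Longrightarrow> A \<noteq> Top \<Longrightarrow> \<exists>\<mu>\<ge>\<alpha>. wge \<mu> A \<and> \<not> wge (osuc \<mu>) A"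
proof (induction A)
  case (Dia \<beta> A)
  show ?case
  proof (cases "wge \<beta> A")
    case True
    then show ?thesis using Dia.prems by (intro exI[of _ \<beta>]) (auto simp: osuc_le_iff)
  next
    case False
    then have "A \<noteq> Top" by auto
    then obtain \<mu> where mu: "\<mu> \<ge> \<alpha>" "wge \<mu> A" "\<not> wge (osuc \<mu>) A" using Dia by auto
    then have "\<mu> < \<beta>" using False wge_antimono by (metis not_le)
    then show ?thesis using mu by (intro exI[of _ \<mu>]) auto
  qed
qed auto

lemma worm_derives_Dia_Top: "wge \<alpha> A \<Longrightarrow> A \<noteq> Top \<Longrightarrow> A \<turnstile> Dia \<alpha> Top"
  by (cases A) (auto intro: rc_derives.cut[OF rc_derives.nec[OF rc_derives.top] Dia_antimono])

text \<open>Both worms are decomposed at the least modality \<open>a\<close> in them. If neither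
  proves \<open>Dia a\<close> of the other, each proves \<open>Dia a\<close> of the other's
  remainder, and it remains to compare the heads at level \<open>osuc a\<close>.\<close>

lemma worm_trichotomy:
  "wge \<alpha> A \<Longrightarrow> wge \<alpha> B \<Longrightarrow> A \<turnstile> Dia \<alpha> B \<or> B \<turnstile> Dia \<alpha> A \<or> A \<turnstile> B \<and> B \<turnstile> A"
proof (induction "size A + size B" arbitrary: \<alpha> A B rule: less_induct)
  case (less A B \<alpha>)
  show ?case
  proof (cases "A = Top \<or> B = Top")
    case True
    then show ?thesis using less.prems worm_derives_Dia_Top rc_derives.refl by metis
  next
    case False
    then obtain \<mu> \<nu> where mu: "\<alpha> \<le> \<mu>" "wge \<mu> A" "\<not> wge (osuc \<mu>) A"
      and nu: "\<alpha> \<le> \<nu>" "wge \<nu> B" "\<not> wge (osuc \<nu>) B"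
      using less.prems least_modality by metis
    define a where "a = min \<mu> \<nu>"
    have a: "\<alpha> \<le> a" "wge a A" "wge a B" "\<not> (wge (osuc a) A \<and> wge (osuc a) B)"
      using mu nu wge_antimono[OF mu(2), of \<nu>] wge_antimono[OF nu(2), of \<mu>]
      unfolding a_def by (auto simp: min_def)
    obtain A1 S where A: "decomposes a A A1 S" using worm_decomposes[OF a(2)] by blast
    obtain B1 T where B: "decomposes a B B1 T" using worm_decomposes[OF a(3)] by blast
    have down: "X \<turnstile> Dia a Z"
      if "X \<turnstile> Dia a Y" "Y \<turnstile> Dia a Z \<or> Y \<turnstile> Z" for X Y Z :: "'a rc"
      using that rc_derives.nec rc_derives.cut rc_derives.trans4 by metis
    have "A \<turnstile> Dia a B \<or> B \<turnstile> Dia a A \<or> A \<turnstile> B \<and> B \<turnstile> A"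
    proof (cases "A \<turnstile> Dia a B \<or> B \<turnstile> Dia a A")
      case nD: False
      \<comment> \<open>The smaller remainder \<open>Y\<close> is compared with \<open>A\<close>;
        any other outcome gives \<open>B \<turnstile> Dia a A\<close> through
        \<open>B \<turnstile> Dia a Y\<close>.\<close>
      have AT: "A \<turnstile> Dia a Y" if "Y \<in> T" for Y
        using less.hyps[of A Y a] B that a(2) down[of B Y A] nD
        unfolding decomposes_def by auto
      have BS: "B \<turnstile> Dia a Y" if "Y \<in> S" for Y
        using less.hyps[of Y B a] A that a(3) down[of A Y B] nD
        unfolding decomposes_def by auto
      \<comment> \<open>By its choice \<open>a\<close> occurs in one of the worms, so passing to the
        heads lowers the total size.\<close>
      have "S \<noteq> {} \<or> T \<noteq> {}" using A B a(4) unfolding decomposes_def by blast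
      then have "size A1 + size B1 < size A + size B"
        using A B unfolding decomposes_def by (metis add_le_less_mono add_less_le_mono)
      moreover have A1: "wge (osuc a) A1" "A \<turnstile> A1" and B1: "wge (osuc a) B1" "B \<turnstile> B1"
        using A B unfolding decomposes_def by blast+
      ultimately consider "A1 \<turnstile> Dia (osuc a) B1" | "B1 \<turnstile> Dia (osuc a) A1" | "A1 \<turnstile> B1" "B1 \<turnstile> A1"
        using less.hyps[of A1 B1 "osuc a"] by blast
      then show ?thesis
      proof cases
        case 1
        have "A \<turnstile> Dia (osuc a) B"
          using B AT rc_derives.cut[OF A1(2) 1] unfolding decomposes_def by blast
        then have "A \<turnstile> Dia a B"
          by (rule rc_derives.cut) (rule rc_derives.mono, simp)
        then show ?thesis by blast
      next
        case 2
        have "B \<turnstile> Dia (osuc a) A"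
          using A BS rc_derives.cut[OF B1(2) 2] unfolding decomposes_def by blast
        then have "B \<turnstile> Dia a A"
          by (rule rc_derives.cut) (rule rc_derives.mono, simp)
        then show ?thesis by blast
      next
        case 3
        have "A \<turnstile> B"
          using B AT rc_derives.cut[OF A1(2) 3(1)] unfolding decomposes_def by blast
        moreover have "B \<turnstile> A"
          using A BS rc_derives.cut[OF B1(2) 3(2)] unfolding decomposes_def by blast
        ultimately show ?thesis by blast
      qed
    qed blast
    then show ?thesis using Dia_antimono[OF a(1)] rc_derives.cut by blast
  qed
qed

section \<open>The orders of worms\<close>

lemma hlog_val_wge:
  assumes "wge \<xi> B" "\<eta> \<le> \<xi>"
  shows "hlog \<eta> (val B) = E (lsub \<eta> \<xi>) (hlog \<xi> (val B))"
  using assms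
proof (induction B arbitrary: \<eta>)
  case Top
  have "val Top = (ozero::'a)" unfolding val_def by (rule Least_equality) auto
  moreover have "E (lsub \<eta> \<xi>) ozero = ozero"
    using hlog_ge_lsub[OF Top(2), of ozero] by simp
  ultimately show ?case by simp
next
  case (Dia \<alpha> B)
  let ?v = "val (Dia \<alpha> B)"
  \<comment> \<open>A competitor for \<open>?v\<close>: equal to it from \<open>\<xi>\<close> on,
    exponential and no larger below. By induction it still forces the worm, so minimality of
    \<open>?v\<close> gives equality.\<close>
  define y where "y = E \<xi> (hlog \<xi> ?v)"
  have B: "B \<in> worms" "Dia \<alpha> B \<in> worms" "\<xi> \<le> \<alpha>" "wge \<xi> B"
    using Dia.prems wge_worms by (auto intro: worms.intros)
  have acc: "acc \<alpha> ?v (val B)"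
    using forces_val[OF B(2)] forces_Dia_iff[OF B(1)] by blast
  have y: "hlog \<eta> y = E (lsub \<eta> \<xi>) (hlog \<xi> ?v)" if "\<eta> \<le> \<xi>" for \<eta>
    unfolding y_def using that by (rule hlog_E_le)
  have y': "hlog \<eta> y = hlog \<eta> ?v" if "\<xi> \<le> \<eta>" for \<eta>
    by (rule hlog_determined[OF _ that]) (simp add: y_def)
  have "hlog \<eta> (val B) < hlog \<eta> y" if "\<eta> \<le> \<alpha>" for \<eta>
  proof (cases "\<eta> \<le> \<xi>")
    case True
    then show ?thesis using Dia.IH[OF B(4) True] acc B(3) y by (simp add: acc_def)
  next
    case False
    then show ?thesis using y'[of \<eta>] acc that by (simp add: acc_def)
  qed
  then have "forces y (Dia \<alpha> B)" using forces_Dia_iff[OF B(1)] by (simp add: acc_def)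
  then have "hlog \<eta> ?v \<le> hlog \<eta> y" by (rule hlog_val_le[OF B(2)])
  then show ?case
    using y[OF Dia.prems(2)] hlog_ge_lsub[OF Dia.prems(2), of ?v] by simp
qed auto

lemma hlog_val_derives:
  assumes "A \<in> worms" "B \<in> worms" "A \<turnstile> B" shows "hlog \<eta> (val B) \<le> hlog \<eta> (val A)"
  using hlog_val_le[OF assms(2) soundness[OF assms(3) forces_val[OF assms(1)]]] .

lemma hlog_val_less:
  assumes "A \<in> worms" "B \<in> worms" "A \<turnstile> Dia \<xi> B" shows "hlog \<xi> (val B) < hlog \<xi> (val A)"
proof -
  have "forces (val A) (Dia \<xi> B)" by (rule soundness[OF assms(3) forces_val[OF assms(1)]])
  then show ?thesis using forces_Dia_iff[OF assms(2)] by (simp add: acc_def)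
qed

section \<open>Every ordinal is a value\<close>

text \<open>Some iterated logarithm drops below \<open>\<beta>\<close>. The first drop is not at a
  successor, since \<open>\<ell>\<close> fixes \<open>\<beta>\<close>; at a limit it displays
  \<open>\<beta>\<close> as an exponential of the smaller value.\<close>

lemma hlog_fixpoint_descends:
  fixes \<beta> :: "'o::ordinals"
  assumes "\<ell> \<beta> = \<beta>" "\<beta> \<noteq> ozero"
  shows "\<exists>d \<gamma>. \<gamma> < \<beta> \<and> \<beta> = E d \<gamma>"
proof -
  have "\<exists>\<eta>. hlog \<eta> \<beta> < \<beta>"
  proof (rule ccontr)
    assume "\<nexists>\<eta>. hlog \<eta> \<beta> < \<beta>"
    \<comment> \<open>Constancy up to \<open>osuc \<beta>\<close> would bound an exponential by
      \<open>\<beta>\<close>, although by \<open>le_E_oone\<close> it is at least its exponent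
      \<open>osuc \<beta>\<close>.\<close>
    then have "hlog (osuc \<beta>) \<beta> = \<beta>" using hlog_le by (metis order.order_iff_strict)
    then have "E (osuc \<beta>) \<beta> \<le> \<beta>" using hlog_ge_lsub[of ozero "osuc \<beta>" \<beta>] by simp
    moreover have "osuc \<beta> \<le> E (osuc \<beta>) oone" by (rule le_E_oone)
    moreover have "E (osuc \<beta>) oone \<le> E (osuc \<beta>) \<beta>" using assms(2) by (simp add: oone_le_iff)
    ultimately have "osuc \<beta> \<le> \<beta>" by (meson order.trans)
    then show False by (simp add: osuc_le_iff)
  qed
  define \<eta> where "\<eta> = (LEAST \<eta>. hlog \<eta> \<beta> < \<beta>)"
  have eta: "hlog \<eta> \<beta> < \<beta>" unfolding \<eta>_def by (rule LeastI_ex) fact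
  have below: "hlog \<zeta> \<beta> = \<beta>" if "\<zeta> < \<eta>" for \<zeta>
    using not_less_Least[of \<zeta> "\<lambda>\<eta>. hlog \<eta> \<beta> < \<beta>"] that hlog_le[of \<zeta> \<beta>]
    by (simp add: \<eta>_def)
  show ?thesis
  proof (cases \<eta> rule: ord_cases)
    case (suc \<zeta>)
    then show ?thesis using eta below[of \<zeta>] assms(1) by (simp add: hlog_osuc)
  next
    case limit
    obtain \<theta> where "\<theta> < \<eta>" "\<And>\<zeta>. \<theta> \<le> \<zeta> \<Longrightarrow> \<zeta> < \<eta> \<Longrightarrow> hlog \<zeta> \<beta> = E (lsub \<zeta> \<eta>) (hlog \<eta> \<beta>)"
      using hlog_limit[OF limit] by blast
    then have "\<beta> = E (lsub \<theta> \<eta>) (hlog \<eta> \<beta>)" using below[of \<theta>] by simp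
    then show ?thesis using eta by blast
  qed (use eta in simp)
qed

text \<open>A nonzero fixpoint of \<open>\<ell>\<close> is some \<open>E d \<gamma>\<close> and
  comes from a worm for \<open>\<gamma>\<close> at level \<open>\<xi> \<oplus> d\<close>. Any other
  nonzero \<open>\<beta>\<close> is \<open>\<delta> \<oplus> omega_pow c\<close> and comes from
  joining worms for the smaller \<open>c\<close> at \<open>osuc \<xi>\<close> and
  \<open>\<delta>\<close> at \<open>\<xi>\<close>.\<close>

lemma hlog_val_surj: "\<exists>B. wge \<xi> B \<and> hlog \<xi> (val B) = (\<beta>::'o::ordinals)"
proof (induction \<beta> arbitrary: \<xi> rule: less_induct)
  case (less \<beta>)
  consider "\<beta> = ozero" | "\<beta> \<noteq> ozero" "\<ell> \<beta> = \<beta>" | "\<beta> \<noteq> ozero" "\<ell> \<beta> < \<beta>"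
    using last_exp_le[of \<beta>] by fastforce
  then show ?case
  proof cases
    case 1
    have "val Top = (ozero::'o)" unfolding val_def by (rule Least_equality) auto
    then show ?thesis using 1 by (intro exI[of _ Top]) simp
  next
    case 2
    obtain d \<gamma> where d: "\<gamma> < \<beta>" "\<beta> = E d \<gamma>" using hlog_fixpoint_descends[OF 2(2,1)] by blast
    obtain B where B: "wge (\<xi> \<oplus> d) B" "hlog (\<xi> \<oplus> d) (val B) = \<gamma>" using less[OF d(1)] by blast
    have "hlog \<xi> (val B) = E d \<gamma>" using hlog_val_wge[OF B(1), of \<xi>] B(2) by simp
    moreover have "wge \<xi> B" by (rule wge_antimono[OF B(1)]) simp
    ultimately show ?thesis using d by blast
  next
    case 3
    define c where "c = \<ell> \<beta>"
    obtain \<delta> where \<delta>: "\<beta> = \<delta> \<oplus> omega_pow c" unfolding c_def using last_exp_decomp[OF 3(1)] by blast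
    have "\<delta> < \<beta>" using oplus_strict_mono[of ozero "omega_pow c" \<delta>] \<delta> by simp
    then obtain D where D: "wge \<xi> D" "hlog \<xi> (val D) = \<delta>" using less by blast
    obtain C where C: "wge (osuc \<xi>) C" "hlog (osuc \<xi>) (val C) = c"
      using less 3(2) unfolding c_def by blast
    define B where "B = wcat C (Dia \<xi> D)"
    have wC: "wge \<xi> C" by (rule wge_antimono[OF C(1)]) (simp add: less_imp_le)
    then have wB: "wge \<xi> B" unfolding B_def using D by (intro wge_wcat) simp_all
    note worms = wge_worms[OF wB] wge_worms[OF wC] wge_worms[OF D(1)]
    have "B \<turnstile> C" unfolding B_def using C(1) by (rule wcat_left)
    then have "c \<le> \<ell> (hlog \<xi> (val B))"
      using hlog_val_derives[of B C "osuc \<xi>"] worms C(2) by (simp add: hlog_osuc)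
    moreover have "B \<turnstile> Dia \<xi> D" unfolding B_def using C(1) by (rule wcat_right)
    then have "\<delta> < hlog \<xi> (val B)" using hlog_val_less[of B D \<xi>] worms D(2) by simp
    \<comment> \<open>Ordinals strictly between \<open>\<delta>\<close> and \<open>\<beta>\<close>
      have last exponent below \<open>c\<close>.\<close>
    ultimately have ge: "\<beta> \<le> hlog \<xi> (val B)"
      using last_exp_between[of \<delta> "hlog \<xi> (val B)" c] \<delta> by (meson not_le)
    \<comment> \<open>For the upper bound: this point has value \<open>\<beta>\<close> at
      \<open>\<xi>\<close> and will be shown to force \<open>B\<close>.\<close>
    define y where "y = E \<xi> \<beta>"
    have y: "hlog \<eta> y = E (lsub \<eta> \<xi>) \<beta>" if "\<eta> \<le> \<xi>" for \<eta>
      unfolding y_def using that by (rule hlog_E_le)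
    have ysuc: "hlog (osuc \<xi>) y = hlog (osuc \<xi>) (val C)"
      using C(2) by (simp add: y_def hlog_osuc c_def)
    have "acc \<xi> y (val D)"
      using y hlog_val_wge[OF D(1)] D(2) \<open>\<delta> < \<beta>\<close> by (simp add: acc_def)
    then have "forces y (Dia \<xi> D)" using forces_Dia_iff[OF worms(3)] by blast
    moreover have "hlog \<eta> (val C) \<le> hlog \<eta> y" for \<eta>
    proof (cases "\<eta> \<le> osuc \<xi>")
      case True
      then show ?thesis
        using hlog_val_wge[OF C(1) True] hlog_ge_lsub[OF True, of y] ysuc by simp
    next
      case False
      then show ?thesis using hlog_determined[OF ysuc, of \<eta>] by simp
    qed
    then have "forces y C" using forces_iff[OF worms(2)] by blast
    ultimately have "forces y B"
      unfolding B_def using soundness[OF wcat_join[OF C(1), of D], of y] by simp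
    then have "hlog \<xi> (val B) \<le> hlog \<xi> y" by (rule hlog_val_le[OF worms(1)])
    then have "hlog \<xi> (val B) = \<beta>" using ge y[of \<xi>] by simp
    then show ?thesis using wB by blast
  qed
qed

text \<open>After the head comes a modality \<open>\<mu> < \<xi>\<close>; amalgamation makes
  \<open>val h\<close> force the rest by changing only coordinates up to
  \<open>\<mu>\<close>.\<close>

lemma head_same_hlog:
  assumes A: "A \<in> worms"
  shows "\<exists>h. wge \<xi> h \<and> A \<turnstile> h \<and> hlog \<xi> (val h) = hlog \<xi> (val A)"
proof -
  consider "wge \<xi> A" | h \<mu> C where "wge \<xi> h" "\<mu> < \<xi>" "wge ozero C" "A = wcat h (Dia \<mu> C)"
    using worm_split[OF worms_wge[OF A]] by blast
  then show ?thesis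
  proof cases
    case 1
    then show ?thesis using rc_derives.refl by blast
  next
    case 2
    have h: "wge (osuc \<mu>) h" using 2 wge_antimono osuc_le_iff by blast
    note worms = wge_worms[OF 2(1)] wge_worms[OF 2(3)]
    have Ah: "A \<turnstile> h" using wcat_left[OF h] 2(4) by simp
    obtain w where w: "\<And>\<eta>. hlog \<eta> (val h) \<le> hlog \<eta> w" "acc \<mu> w (val C)"
      "\<And>\<eta>. \<mu> < \<eta> \<Longrightarrow> hlog \<eta> w = hlog \<eta> (val h)"
      using amalgamation[where k = "val h" and c = "val C" and \<mu> = \<mu>] by metis
    have "forces w h" using forces_iff[OF worms(1)] w(1) by blast
    moreover have "forces w (Dia \<mu> C)" using forces_Dia_iff[OF worms(2)] w(2) by blast
    ultimately have "forces w A" using soundness[OF wcat_join[OF h, of C], of w] 2(4) by simp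
    then have "hlog \<xi> (val A) \<le> hlog \<xi> (val h)"
      using hlog_val_le[OF A, of w \<xi>] w(3)[OF 2(2)] by simp
    then have "hlog \<xi> (val h) = hlog \<xi> (val A)"
      using hlog_val_derives[OF A worms(1) Ah, of \<xi>] by simp
    then show ?thesis using 2(1) Ah by blast
  qed
qed

section \<open>Identification of the order of a worm\<close>

text \<open>A worm \<open>B\<close> with value \<open>\<beta>\<close> is compared with the head
  \<open>h\<close>; by soundness only the outcome \<open>h \<turnstile> Dia \<xi> B\<close> fits the
  values.\<close>

lemma worm_less_downward:
  assumes A: "A \<in> worms" and less: "\<beta> < hlog \<xi> (val A)"
  shows "\<exists>B\<in>worms. A \<turnstile> Dia \<xi> B \<and> hlog \<xi> (val B) = \<beta>"
proof -
  obtain h where h: "wge \<xi> h" "A \<turnstile> h" "hlog \<xi> (val h) = hlog \<xi> (val A)"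
    using head_same_hlog[OF A] by blast
  obtain B where B: "wge \<xi> B" "hlog \<xi> (val B) = \<beta>" using hlog_val_surj by blast
  note worms = wge_worms[OF h(1)] wge_worms[OF B(1)]
  have "\<not> B \<turnstile> h" using hlog_val_derives[OF worms(2,1), of \<xi>] h(3) B(2) less by auto
  moreover have "\<not> B \<turnstile> Dia \<xi> h" using hlog_val_less[OF worms(2,1), of \<xi>] h(3) B(2) less by auto
  ultimately have "h \<turnstile> Dia \<xi> B" using worm_trichotomy[OF h(1) B(1)] by blast
  then have "A \<turnstile> Dia \<xi> B" by (rule rc_derives.cut[OF h(2)])
  then show ?thesis using worms B(2) by blast
qed

lemma wf_worm_less: "wf (worm_less \<xi> :: 'o::ordinals rc rel)"
proof (rule wf_subset)
  show "wf (inv_image {(x, y). x < y} (\<lambda>A :: 'o rc. hlog \<xi> (val A)))" by (simp add: wf)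
  show "worm_less \<xi> \<subseteq> inv_image {(x, y). x < y} (\<lambda>A :: 'o rc. hlog \<xi> (val A))"
    by (auto simp: worm_less_def hlog_val_less)
qed

lemma worm_ord_rec: "worm_ord \<xi> A = osup ((\<lambda>B. osuc (worm_ord \<xi> B)) ` {B. (B, A) \<in> worm_less \<xi>})"
  unfolding worm_ord_def
  by (subst wfrec[OF wf_worm_less])
    (rule arg_cong[where f = osup], rule image_cong, simp_all add: cut_apply)

lemma worm_ord_eq: "A \<in> worms \<Longrightarrow> worm_ord \<xi> A = hlog \<xi> (val A)"
proof (induction A rule: wf_induct_rule[OF wf_worm_less[of \<xi>]])
  case (1 A)
  let ?S = "{B. (B, A) \<in> worm_less \<xi>}"
  have IH: "worm_ord \<xi> B = hlog \<xi> (val B)" "osuc (hlog \<xi> (val B)) \<le> hlog \<xi> (val A)" if "B \<in> ?S" for B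
    using 1 that by (auto simp: worm_less_def hlog_val_less osuc_le_iff)
  then have le: "b \<le> hlog \<xi> (val A)" if "b \<in> (\<lambda>B. osuc (worm_ord \<xi> B)) ` ?S" for b
    using that by auto
  \<comment> \<open>If the supremum \<open>?s\<close> fell short, some predecessor \<open>B\<close>
    of \<open>A\<close> would have value \<open>?s\<close>, giving
    \<open>osuc ?s \<le> ?s\<close>.\<close>
  have "hlog \<xi> (val A) \<le> osup ((\<lambda>B. osuc (worm_ord \<xi> B)) ` ?S)" (is "_ \<le> ?s")
  proof (rule ccontr)
    assume "\<not> ?thesis"
    then have "?s < hlog \<xi> (val A)" by simp
    from worm_less_downward[OF 1(2) this] obtain B
      where B: "B \<in> worms" "A \<turnstile> Dia \<xi> B" "hlog \<xi> (val B) = ?s" by blast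
    then have "B \<in> ?S" using 1(2) by (simp add: worm_less_def)
    then have "osuc (worm_ord \<xi> B) \<le> ?s" using le by (intro osup_upper) blast+
    then show False using IH(1)[OF \<open>B \<in> ?S\<close>] B(3) by (simp add: osuc_le_iff)
  qed
  moreover have "?s \<le> hlog \<xi> (val A)" using le by (rule osup_least)
  ultimately show ?case by (subst worm_ord_rec) simp
qed

theorem theorem8p5:
  fixes A :: "'o::ordinals rc" and \<zeta> :: 'o
  assumes "A \<in> worms" and "is_limit \<zeta>"
  shows "\<exists>\<xi><\<zeta>. \<forall>\<theta>. \<xi> \<le> \<theta> \<and> \<theta> < \<zeta> \<longrightarrow>
    worm_ord \<theta> A = hyperation hyperexp (lsub \<theta> \<zeta>) (worm_ord \<zeta> A) \<and>
    hyperation hyperexp (lsub \<theta> \<zeta>) (worm_ord \<zeta> A)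
      = hyperation hyperexp (omega_pow (\<ell> \<zeta>)) (worm_ord \<zeta> A) \<and>
    hyperation hyperexp (omega_pow (\<ell> \<zeta>)) (worm_ord \<zeta> A) = veblen hyperexp (\<ell> \<zeta>) (worm_ord \<zeta> A)"
proof -
  obtain \<theta>\<^sub>0 where th: "\<theta>\<^sub>0 < \<zeta>"
    "\<And>\<theta>. \<theta>\<^sub>0 \<le> \<theta> \<Longrightarrow> \<theta> < \<zeta> \<Longrightarrow> hlog \<theta> (val A) = E (lsub \<theta> \<zeta>) (hlog \<zeta> (val A))"
    using hlog_limit[OF assms(2)] by blast
  have "\<zeta> \<noteq> ozero" using assms(2) by (simp add: is_limit_def)
  then obtain a where a: "\<zeta> = a \<oplus> omega_pow (\<ell> \<zeta>)" by (rule last_exp_decomp)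
  then have "a < \<zeta>" using oplus_strict_mono[of ozero "omega_pow (\<ell> \<zeta>)" a] by simp
  have "lsub \<theta> \<zeta> = omega_pow (\<ell> \<zeta>)" if "a \<le> \<theta>" "\<theta> < \<zeta>" for \<theta>
    using lsub_eventually[of a \<theta> "\<ell> \<zeta>"] that a by simp
  \<comment> \<open>Past both thresholds, \<open>\<theta>\<^sub>0\<close> gives the first equality
    and \<open>a\<close> the second; the third is the value of the hyperation at a power of
    omega.\<close>
  then show ?thesis
    using th \<open>a < \<zeta>\<close> assms(1)
    by (intro exI[of _ "max \<theta>\<^sub>0 a"])
      (simp add: worm_ord_eq hyperation_omega_pow normal_hyperexp)
qed

end
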